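(* Let $W$ be a Weyl tensor with self-dual Weyl tensor $\mathcal W$ and Bel-Robinson tensor $T\neq 0$, and suppose $T^2=0$. Let $u$ be an arbitrary time-like vector, $X=u\otimes u$, and $$\Lambda=\frac{T(X)}{\sqrt{T(X,X)}},\qquad l=-\frac{\Lambda(u)}{\sqrt{\Lambda(u,u)}},\qquad x=*(l\wedge u\wedge w),\qquad p=\frac{x}{\sqrt{g(x,x)}},$$ where $w$ is an arbitrary vector such that $x\neq 0$. Put $L=l\wedge p$ and $\mathcal L_0=\frac{1}{\sqrt2}(L-\mathrm i *L)$. Then $W$ is obtained from $T$ up to a duality rotation: there is a real $\theta$ such that $$\mathcal W=e^{\mathrm i\theta}\,\mathcal W_0,\qquad \mathcal W_0=\mathcal L_0\otimes\mathcal L_0 .$$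
   Context: $(V,g)$ is an oriented 4-dimensional real vector space with a Lorentzian metric of signature $(-,+,+,+)$ (the tangent space of a space-time at a point); indices are moved with $g$; $\eta$ is the metric volume element. Hodge dual: $( *F)_{\alpha\beta}=\frac12\eta_{\alpha\beta\mu\nu}F^{\mu\nu}$ for 2-forms, $( *W)_{\alpha\beta\mu\nu}=\frac12\eta_{\alpha\beta}{}^{\rho\sigma}W_{\rho\sigma\mu\nu}$ for double 2-forms; $*(a\wedge b\wedge c)$ is the vector dual to a 3-form. A Weyl tensor $W$ is a real 4-tensor with the algebraic symmetries of a Riemann tensor and vanishing traces; its self-dual Weyl tensor is $\mathcal W=\frac12(W-\mathrm i*W)$. The Bel-Robinson (BR) tensor of $W$ is $T_{\alpha\mu\beta\nu}=\mathcal W_{\alpha}{}^{\rho}{}_{\beta}{}^{\sigma}\,\overline{\mathcal W}_{\mu\rho\nu\sigma}=\frac14\left(W_{\alpha}{}^{\rho}{}_{\beta}{}^{\sigma}W_{\mu\rho\nu\sigma}+{*W}_{\alpha}{}^{\rho}{}_{\beta}{}^{\sigma}{*W}_{\mu\rho\nu\sigma}\right)$; it is totally symmetric and traceless. $(T^2)_{\alpha\beta\rho\sigma}=T_{\alpha\beta}{}^{\mu\nu}T_{\mu\nu\rho\sigma}$, $T(X)_{\alpha\beta}=T_{\alpha\beta\mu\nu}X^{\mu\nu}$, $T(X,X)=T_{\alpha\beta\mu\nu}X^{\alpha\beta}X^{\mu\nu}$; for a 2-tensor $A$, $A(u)^\alpha=A^\alpha{}_\beta u^\beta$ and $A(u,u)=A_{\alpha\beta}u^\alpha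 u^\beta$. For vectors $(l\wedge p)_{\alpha\beta}=l_\alpha p_\beta-p_\alpha l_\beta$. *)

theory Defs
  imports "HOL-Analysis.Analysis"
begin

text \<open>
  The four-dimensional space is described by its components in an arbitrary, not necessarily
  orthonormal, basis: vectors are elements of \<open>real ^ 4\<close> (contravariant components), the metric is
  an arbitrary Gram matrix \<open>g\<close>, and tensors are given by their covariant components.
  The four elements of the index type \<open>4\<close> are \<open>0, 1, 2, 3\<close>.
\<close>

type_synonym 'a tensor2 = "4 \<Rightarrow> 4 \<Rightarrow> 'a"
type_synonym 'a tensor3 = "4 \<Rightarrow> 4 \<Rightarrow> 4 \<Rightarrow> 'a"
type_synonym 'a tensor4 = "4 \<Rightarrow> 4 \<Rightarrow> 4 \<Rightarrow> 4 \<Rightarrow> 'a"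

definition gprod :: "real^4^4 \<Rightarrow> real^4 \<Rightarrow> real^4 \<Rightarrow> real" where
  "gprod g u v = (\<Sum>\<alpha>\<in>UNIV. \<Sum>\<beta>\<in>UNIV. g $ \<alpha> $ \<beta> * u $ \<alpha> * v $ \<beta>)"

definition lorentzian :: "real^4^4 \<Rightarrow> bool" where
  "lorentzian g \<longleftrightarrow> transpose g = g \<and>
     (\<exists>e :: 4 \<Rightarrow> real^4. \<forall>i j. gprod g (e i) (e j) =
        (if i \<noteq> j then 0 else if i = 0 then -1 else 1))"

definition time_like :: "real^4^4 \<Rightarrow> real^4 \<Rightarrow> bool" where
  "time_like g u \<longleftrightarrow> gprod g u u < 0"

abbreviation ginv :: "real^4^4 \<Rightarrow> 4 \<Rightarrow> 4 \<Rightarrow> real" where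
  "ginv g \<alpha> \<beta> \<equiv> matrix_inv g $ \<alpha> $ \<beta>"

definition lower :: "real^4^4 \<Rightarrow> real^4 \<Rightarrow> 4 \<Rightarrow> real" where
  "lower g v \<alpha> = (\<Sum>\<beta>\<in>UNIV. g $ \<alpha> $ \<beta> * v $ \<beta>)"

definition raise1 :: "real^4^4 \<Rightarrow> (4 \<Rightarrow> real) \<Rightarrow> real^4" where
  "raise1 g a = (\<chi> \<alpha>. \<Sum>\<beta>\<in>UNIV. ginv g \<alpha> \<beta> * a \<beta>)"

definition raise2 :: "real^4^4 \<Rightarrow> real tensor2 \<Rightarrow> real tensor2" where
  "raise2 g F \<mu> \<nu> = (\<Sum>\<rho>\<in>UNIV. \<Sum>\<sigma>\<in>UNIV. ginv g \<mu> \<rho> * ginv g \<nu> \<sigma> * F \<rho> \<sigma>)"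

definition raise3 :: "real^4^4 \<Rightarrow> real tensor3 \<Rightarrow> real tensor3" where
  "raise3 g F \<kappa> \<mu> \<nu> = (\<Sum>\<tau>\<in>UNIV. \<Sum>\<rho>\<in>UNIV. \<Sum>\<sigma>\<in>UNIV.
     ginv g \<kappa> \<tau> * ginv g \<mu> \<rho> * ginv g \<nu> \<sigma> * F \<tau> \<rho> \<sigma>)"

text \<open>
  \<open>levi_civita\<close> is the permutation symbol, with \<open>levi_civita 0 1 2 3 = 1\<close>. An orientation is the
  choice of one of the two metric volume elements.
\<close>

definition levi_civita :: "real tensor4" where
  "levi_civita \<alpha> \<beta> \<gamma> \<delta> =
     det (\<chi> i. axis (if i = 0 then \<alpha> else if i = 1 then \<beta> else if i = 2 then \<gamma> else \<delta>) 1 :: real^4^4)"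

definition volume_element :: "real^4^4 \<Rightarrow> real tensor4 \<Rightarrow> bool" where
  "volume_element g \<eta> \<longleftrightarrow> (\<exists>s\<in>{1, -1}. \<forall>\<alpha> \<beta> \<gamma> \<delta>.
     \<eta> \<alpha> \<beta> \<gamma> \<delta> = s * sqrt \<bar>det g\<bar> * levi_civita \<alpha> \<beta> \<gamma> \<delta>)"

definition hodge2 :: "real^4^4 \<Rightarrow> real tensor4 \<Rightarrow> real tensor2 \<Rightarrow> real tensor2" where
  "hodge2 g \<eta> F \<alpha> \<beta> = (1/2) * (\<Sum>\<mu>\<in>UNIV. \<Sum>\<nu>\<in>UNIV. \<eta> \<alpha> \<beta> \<mu> \<nu> * raise2 g F \<mu> \<nu>)"

text \<open>The dual of a 3-form is normalised as that of a 2-form and returned as a vector.\<close>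

definition hodge3 :: "real^4^4 \<Rightarrow> real tensor4 \<Rightarrow> real tensor3 \<Rightarrow> real^4" where
  "hodge3 g \<eta> F = raise1 g (\<lambda>\<alpha>. (1/6) *
     (\<Sum>\<kappa>\<in>UNIV. \<Sum>\<mu>\<in>UNIV. \<Sum>\<nu>\<in>UNIV. \<eta> \<alpha> \<kappa> \<mu> \<nu> * raise3 g F \<kappa> \<mu> \<nu>))"

text \<open>Double 2-forms are dualised on the first pair of indices.\<close>

definition hodge_double :: "real^4^4 \<Rightarrow> real tensor4 \<Rightarrow> real tensor4 \<Rightarrow> real tensor4" where
  "hodge_double g \<eta> W \<alpha> \<beta> \<mu> \<nu> = hodge2 g \<eta> (\<lambda>\<rho> \<sigma>. W \<rho> \<sigma> \<mu> \<nu>) \<alpha> \<beta>"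

definition wedge2 :: "real^4^4 \<Rightarrow> real^4 \<Rightarrow> real^4 \<Rightarrow> real tensor2" where
  "wedge2 g l p \<alpha> \<beta> = lower g l \<alpha> * lower g p \<beta> - lower g p \<alpha> * lower g l \<beta>"

definition wedge3 :: "real^4^4 \<Rightarrow> real^4 \<Rightarrow> real^4 \<Rightarrow> real^4 \<Rightarrow> real tensor3" where
  "wedge3 g a b c \<alpha> \<beta> \<gamma> =
     lower g a \<alpha> * wedge2 g b c \<beta> \<gamma> + lower g a \<beta> * wedge2 g b c \<gamma> \<alpha>
       + lower g a \<gamma> * wedge2 g b c \<alpha> \<beta>"

definition weyl_tensor :: "real^4^4 \<Rightarrow> real tensor4 \<Rightarrow> bool" where
  "weyl_tensor g W \<longleftrightarrow>
     (\<forall>\<alpha> \<beta> \<mu> \<nu>. W \<beta> \<alpha> \<mu> \<nu> = - W \<alpha> \<beta> \<mu> \<nu>) \<and>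
     (\<forall>\<alpha> \<beta> \<mu> \<nu>. W \<alpha> \<beta> \<nu> \<mu> = - W \<alpha> \<beta> \<mu> \<nu>) \<and>
     (\<forall>\<alpha> \<beta> \<mu> \<nu>. W \<mu> \<nu> \<alpha> \<beta> = W \<alpha> \<beta> \<mu> \<nu>) \<and>
     (\<forall>\<alpha> \<beta> \<mu> \<nu>. W \<alpha> \<beta> \<mu> \<nu> + W \<alpha> \<mu> \<nu> \<beta> + W \<alpha> \<nu> \<beta> \<mu> = 0) \<and>
     (\<forall>\<beta> \<nu>. (\<Sum>\<alpha>\<in>UNIV. \<Sum>\<mu>\<in>UNIV. ginv g \<alpha> \<mu> * W \<alpha> \<beta> \<mu> \<nu>) = 0)"

definition self_dual_weyl :: "real^4^4 \<Rightarrow> real tensor4 \<Rightarrow> real tensor4 \<Rightarrow> complex tensor4" where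
  "self_dual_weyl g \<eta> W \<alpha> \<beta> \<mu> \<nu> =
     (1/2) * (of_real (W \<alpha> \<beta> \<mu> \<nu>) - \<i> * of_real (hodge_double g \<eta> W \<alpha> \<beta> \<mu> \<nu>))"

text \<open>\<open>bel_contr g A B \<alpha> \<mu> \<beta> \<nu>\<close> contracts the second and fourth indices of \<open>A\<close>, whose first and third
  are \<open>\<alpha>, \<beta>\<close>, with those of \<open>B\<close>, whose first and third are \<open>\<mu>, \<nu>\<close>.\<close>

definition bel_contr :: "real^4^4 \<Rightarrow> ('a::real_algebra) tensor4 \<Rightarrow> 'a tensor4 \<Rightarrow> 'a tensor4" where
  "bel_contr g A B \<alpha> \<mu> \<beta> \<nu> =
     (\<Sum>\<rho>\<in>UNIV. \<Sum>\<sigma>\<in>UNIV. \<Sum>\<rho>'\<in>UNIV. \<Sum>\<sigma>'\<in>UNIV.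
        (ginv g \<rho> \<rho>' * ginv g \<sigma> \<sigma>') *\<^sub>R (A \<alpha> \<rho>' \<beta> \<sigma>' * B \<mu> \<rho> \<nu> \<sigma>))"

definition bel_robinson :: "real^4^4 \<Rightarrow> real tensor4 \<Rightarrow> real tensor4 \<Rightarrow> real tensor4" where
  "bel_robinson g \<eta> W \<alpha> \<mu> \<beta> \<nu> = (1/4) * (bel_contr g W W \<alpha> \<mu> \<beta> \<nu>
     + bel_contr g (hodge_double g \<eta> W) (hodge_double g \<eta> W) \<alpha> \<mu> \<beta> \<nu>)"

text \<open>The real definition agrees with the contraction of the self-dual Weyl tensor with its
  conjugate (whose imaginary part vanishes for a Weyl tensor).\<close>

lemma bel_robinson_eq_Re:
  "bel_robinson g \<eta> W \<alpha> \<mu> \<beta> \<nu> =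
     Re (bel_contr g (self_dual_weyl g \<eta> W) (\<lambda>a b c d. cnj (self_dual_weyl g \<eta> W a b c d)) \<alpha> \<mu> \<beta> \<nu>)"
  by (simp add: bel_robinson_def bel_contr_def self_dual_weyl_def sum_distrib_left
      flip: sum.distrib) (simp add: algebra_simps)

definition tensor4_square :: "real^4^4 \<Rightarrow> real tensor4 \<Rightarrow> real tensor4" where
  "tensor4_square g T \<alpha> \<beta> \<rho> \<sigma> =
     (\<Sum>\<mu>\<in>UNIV. \<Sum>\<nu>\<in>UNIV. raise2 g (T \<alpha> \<beta>) \<mu> \<nu> * T \<mu> \<nu> \<rho> \<sigma>)"

text \<open>Below, \<open>X\<close> has contravariant components.\<close>

definition tensor4_apply :: "real tensor4 \<Rightarrow> real tensor2 \<Rightarrow> real tensor2" where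
  "tensor4_apply T X \<alpha> \<beta> = (\<Sum>\<mu>\<in>UNIV. \<Sum>\<nu>\<in>UNIV. T \<alpha> \<beta> \<mu> \<nu> * X \<mu> \<nu>)"

definition tensor4_quad :: "real tensor4 \<Rightarrow> real tensor2 \<Rightarrow> real" where
  "tensor4_quad T X = (\<Sum>\<alpha>\<in>UNIV. \<Sum>\<beta>\<in>UNIV. \<Sum>\<mu>\<in>UNIV. \<Sum>\<nu>\<in>UNIV.
     T \<alpha> \<beta> \<mu> \<nu> * X \<alpha> \<beta> * X \<mu> \<nu>)"

definition tensor2_apply :: "real^4^4 \<Rightarrow> real tensor2 \<Rightarrow> real^4 \<Rightarrow> real^4" where
  "tensor2_apply g A u = raise1 g (\<lambda>\<alpha>. \<Sum>\<beta>\<in>UNIV. A \<alpha> \<beta> * u $ \<beta>)"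

definition tensor2_quad :: "real tensor2 \<Rightarrow> real^4 \<Rightarrow> real" where
  "tensor2_quad A u = (\<Sum>\<alpha>\<in>UNIV. \<Sum>\<beta>\<in>UNIV. A \<alpha> \<beta> * u $ \<alpha> * u $ \<beta>)"

end

theory Submission
  imports Defs
begin

text \<open>
  In an orthonormal frame with time axis along \<open>u\<close>, the self-dual Weyl tensor is a symmetric traceless
  complex \<open>3 \<times> 3\<close> matrix \<open>Q\<close>. The components of \<open>T\<close> with two time indices are read off from the
  hermitian matrix \<open>M = Q Q\<^sup>*\<close>: energy \<open>t = tr M\<close>, momentum \<open>\<plusminus>\<epsilon>\<^sub>i\<^sub>j\<^sub>k Im M\<^sub>j\<^sub>k\<close>, stress \<open>t \<delta> - 2 Re M\<close>.
  Hence the all-time component of \<open>T\<^sup>2\<close> is \<open>4 Re (\<Sum> M\<^sub>i\<^sub>j M\<^sub>i\<^sub>j)\<close>, which equals four times the squared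
  Frobenius norm of \<open>Q\<^sup>2\<close>, so that \<open>Q\<^sup>2 = 0\<close>. For a traceless matrix this makes the adjugate vanish, so
  \<open>Q\<close> has rank one, and its columns are eigenvectors of \<open>n \<times> _\<close> with eigenvalue \<open>\<plusminus>\<i>\<close>, where \<open>n\<close> is the
  unit vector along the momentum and \<open>l = t\<^bsup>1/4\<^esup> (1, n)\<close>. For a unit vector \<open>p\<close> orthogonal to \<open>n\<close> such an
  eigenvector is a multiple of \<open>p \<mp> \<i> n \<times> p\<close>, which is also the direction of \<open>L0\<close>; comparing norms
  leaves only a phase.
\<close>

section \<open>Orthonormal frames\<close>

lemma UNIV_index4: "(UNIV :: 4 set) = {0, 1, 2, 3}"
proof -
  have "(4::4) = 0" by simp
  then show ?thesis unfolding UNIV_4 by (simp only: insert_commute)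
qed

lemma sum_index4: "(\<Sum>i\<in>(UNIV :: 4 set). f i) = f 0 + (f 1 + (f 2 + f 3 :: 'a :: comm_monoid_add))"
proof -
  have "(4::4) = 0" by simp
  then show ?thesis by (simp only: sum_4 ac_simps)
qed

lemma index4_cases: "(i :: 4) = 0 \<or> i = 1 \<or> i = 2 \<or> i = 3"
  using exhaust_4[of i] by auto

lemma gprod_add_left: "gprod g (a + b) c = gprod g a c + gprod g b c"
  by (simp add: gprod_def algebra_simps sum.distrib)

lemma gprod_add_right: "gprod g c (a + b) = gprod g c a + gprod g c b"
  by (simp add: gprod_def algebra_simps sum.distrib)

lemma gprod_scaleR_left: "gprod g (k *\<^sub>R a) c = k * gprod g a c"
  by (simp add: gprod_def algebra_simps sum_distrib_left)

lemma gprod_scaleR_right: "gprod g c (k *\<^sub>R a) = k * gprod g c a"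
  by (simp add: gprod_def algebra_simps sum_distrib_left)

lemma gprod_minus_left: "gprod g (- a) c = - gprod g a c"
  by (simp add: gprod_def sum_negf)

lemma gprod_minus_right: "gprod g c (- a) = - gprod g c a"
  by (simp add: gprod_def sum_negf)

lemma gprod_diff_left: "gprod g (a - b) c = gprod g a c - gprod g b c"
  by (simp add: gprod_def algebra_simps sum_subtractf)

lemma gprod_diff_right: "gprod g c (a - b) = gprod g c a - gprod g c b"
  by (simp add: gprod_def algebra_simps sum_subtractf)

lemmas gprod_linear = gprod_add_left gprod_add_right gprod_diff_left gprod_diff_right gprod_scaleR_left gprod_scaleR_right
  gprod_minus_left gprod_minus_right

lemma gprod_sym:
  assumes "transpose g = g"
  shows "gprod g a b = gprod g b a"
proof -
  have "transpose g $ i $ j = g $ i $ j" for i j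
    using assms by simp
  then have sym: "g $ i $ j = g $ j $ i" for i j
    by (simp add: transpose_def)
  have "gprod g a b = (\<Sum>\<beta>\<in>UNIV. \<Sum>\<alpha>\<in>UNIV. g $ \<beta> $ \<alpha> * a $ \<alpha> * b $ \<beta>)"
    unfolding gprod_def by (subst sum.swap) (simp add: sym)
  then show ?thesis
    by (simp add: gprod_def mult_ac)
qed

text \<open>Diagonal of the Minkowski metric. Each entry is its own inverse, so the same signs serve
  for raising and lowering frame indices.\<close>

definition causal_sign :: "4 \<Rightarrow> real" where
  "causal_sign i = (if i = 0 then -1 else 1)"

lemma causal_sign_simps [simp]:
  "causal_sign 0 = -1" "causal_sign 1 = 1" "causal_sign 2 = 1" "causal_sign 3 = 1"
  "causal_sign i * causal_sign i = 1"
  by (simp_all add: causal_sign_def)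

locale orthonormal_frame =
  fixes g :: "real^4^4" and e :: "4 \<Rightarrow> real^4"
  assumes metric_sym: "transpose g = g"
    and frame: "gprod g (e i) (e j) = (if i = j then causal_sign i else 0)"

text \<open>The frame supplied by \<open>lorentzian\<close> is unrelated to \<open>u\<close>. A
  reflection, which is an isometry, carries its time axis onto the line of \<open>u\<close>, so no
  orthogonalisation is required. The frame may change orientation; that sign is recovered
  later.\<close>

lemma adapted_frame:
  assumes "lorentzian g" and "time_like g u"
  obtains e m where "orthonormal_frame g e" "m > 0" "u = m *\<^sub>R e 0"
proof -
  obtain e :: "4 \<Rightarrow> real^4" where e: "\<And>i j. gprod g (e i) (e j) = (if i = j then causal_sign i else 0)"
    and sym: "transpose g = g"
    using assms(1) unfolding lorentzian_def causal_sign_def by (metis (full_types))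
  note comm = gprod_sym[OF sym]
  define m where "m = sqrt (- gprod g u u)"
  have neg: "gprod g u u < 0" using assms(2) by (simp add: time_like_def)
  then have m: "m > 0" "m * m = - gprod g u u" by (auto simp: m_def)
  define U where "U = (1 / m) *\<^sub>R u"
  have uU: "u = m *\<^sub>R U" using m by (simp add: U_def)
  have UU: "gprod g U U = -1"
    using m neg by (simp add: U_def gprod_linear divide_simps)
  have e0: "gprod g (e 0) (e 0) = -1" by (simp add: e)
  \<comment> \<open>The reflection is along \<open>e 0 + k U\<close>, which must not be null. Its
    norm is \<open>-2 + 2 k g(e 0, U)\<close>, so one of the two signs always works.\<close>
  obtain k :: real where k: "k * k = 1" and N0: "gprod g (e 0 + k *\<^sub>R U) (e 0 + k *\<^sub>R U) \<noteq> 0"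
  proof (cases "gprod g (e 0) U = 1")
    case True
    then show ?thesis
      by (intro that[of "-1"])
        (simp_all add: gprod_linear e0 UU comm[of U "e 0"])
  next
    case False
    then show ?thesis
      by (intro that[of 1]) (simp_all add: gprod_linear e0 UU comm[of U "e 0"])
  qed
  define N where "N = e 0 + k *\<^sub>R U"
  define R where "R v = v + (- (2 * gprod g v N / gprod g N N)) *\<^sub>R N" for v
  have NN: "gprod g N N \<noteq> 0" using N0 by (simp add: N_def)
  have iso: "gprod g (R v) (R w) = gprod g v w" for v w
    using NN by (simp add: R_def gprod_linear comm[of N w] field_simps)
  have NN': "gprod g N N = 2 * gprod g (e 0) N"
    using k by (simp add: N_def gprod_linear e0 UU comm[of U "e 0"] algebra_simps)
  have "R (e 0) = - k *\<^sub>R U"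
    using NN by (simp add: R_def NN') (simp add: N_def)
  then have RU: "U = - k *\<^sub>R R (e 0)"
    using k by (simp add: algebra_simps)
  define f where "f i = (if i = 0 then U else R (e i))" for i
  have "gprod g (f i) (f j) = (if i = j then causal_sign i else 0)" for i j
    using e[of i j] UU by (auto simp: f_def iso gprod_linear RU e)
  then have "orthonormal_frame g f"
    using sym by unfold_locales
  then show ?thesis
    using that[of f m] m uU by (simp add: f_def)
qed

text \<open>The value of a covector on a frame vector. Scalars come from an arbitrary real algebra,
  so that real and complex tensors share one set of rules.\<close>

definition frame_comp :: "(4 \<Rightarrow> real^4) \<Rightarrow> (4 \<Rightarrow> 'a::real_algebra_1) \<Rightarrow> 4 \<Rightarrow> 'a" where
  "frame_comp e f i = (\<Sum>\<alpha>\<in>UNIV. e i $ \<alpha> *\<^sub>R f \<alpha>)"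

lemma frame_comp_add: "frame_comp e (\<lambda>\<alpha>. f \<alpha> + h \<alpha>) i = frame_comp e f i + frame_comp e h i"
  by (simp add: frame_comp_def algebra_simps sum.distrib)

lemma frame_comp_diff: "frame_comp e (\<lambda>\<alpha>. f \<alpha> - h \<alpha>) i = frame_comp e f i - frame_comp e h i"
  by (simp add: frame_comp_def algebra_simps sum_subtractf)

lemma frame_comp_minus: "frame_comp e (\<lambda>\<alpha>. - f \<alpha>) i = - frame_comp e f i"
  by (simp add: frame_comp_def sum_negf)

lemma frame_comp_mult_left: "frame_comp e (\<lambda>\<alpha>. c * f \<alpha>) i = c * frame_comp e f i"
  by (simp add: frame_comp_def sum_distrib_left)

lemma frame_comp_mult_right: "frame_comp e (\<lambda>\<alpha>. f \<alpha> * c) i = frame_comp e f i * c"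
  by (simp add: frame_comp_def sum_distrib_right)

lemma frame_comp_sum: "frame_comp e (\<lambda>\<alpha>. \<Sum>k\<in>A. f k \<alpha>) i = (\<Sum>k\<in>A. frame_comp e (f k) i)"
  unfolding frame_comp_def scaleR_sum_right by (rule sum.swap)

lemma frame_comp_of_real:
  "frame_comp e (\<lambda>\<alpha>. of_real (f \<alpha>)) i = (of_real (frame_comp e f i) :: 'a::real_algebra_1)"
  by (simp add: frame_comp_def of_real_def scaleR_sum_left)

lemma frame_comp_zero: "frame_comp e (\<lambda>\<alpha>. 0) i = 0"
  by (simp add: frame_comp_def)

lemma frame_comp_swap:
  "frame_comp e (\<lambda>\<alpha>. frame_comp e (F \<alpha>) j) i = frame_comp e (\<lambda>\<beta>. frame_comp e (\<lambda>\<alpha>. F \<alpha> \<beta>) i) j"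
  unfolding frame_comp_def scaleR_sum_right by (subst sum.swap) (simp add: mult.commute)

lemmas frame_comp_linear = frame_comp_add frame_comp_diff frame_comp_minus frame_comp_mult_left
  frame_comp_mult_right frame_comp_sum frame_comp_of_real frame_comp_zero

section \<open>Completeness relation and the inverse metric\<close>

context orthonormal_frame
begin

definition frame_matrix :: "real^4^4" where "frame_matrix = (\<chi> i \<alpha>. e i $ \<alpha>)"

definition sign_matrix :: "real^4^4" where "sign_matrix = (\<chi> i j. if i = j then causal_sign i else 0)"

lemma frame_gram: "frame_matrix ** g ** transpose frame_matrix = sign_matrix"
proof -
  have "(frame_matrix ** g ** transpose frame_matrix) $ i $ j = gprod g (e i) (e j)" for i j
    unfolding gprod_def
    by (subst sum.swap)
      (simp add: matrix_matrix_mult_def frame_matrix_def transpose_def sum_distrib_left sum_distrib_right mult_ac)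
  then show ?thesis
    by (simp add: vec_eq_iff frame sign_matrix_def)
qed

lemma sign_matrix_square: "sign_matrix ** sign_matrix = mat 1"
  by (simp add: vec_eq_iff matrix_matrix_mult_def sign_matrix_def mat_def mult_delta_left)

text \<open>With \<open>E\<close> the frame matrix and \<open>S\<close> the sign matrix,
  \<open>E g E^T = S\<close> gives \<open>E (g E^T S) = 1\<close>. One-sided inverses of square
  matrices are two-sided, so \<open>E\<close> may be moved to the right. Since
  \<open>matrix_inv\<close> is a choice operator, an explicit inverse is what makes its defining
  property available.\<close>

lemma metric_inverse: "matrix_inv g = transpose frame_matrix ** sign_matrix ** frame_matrix"
  and metric_matrix_inv: "matrix_inv g ** g = mat 1"
proof -
  let ?h = "transpose frame_matrix ** sign_matrix ** frame_matrix"
  have "frame_matrix ** (g ** transpose frame_matrix ** sign_matrix) = mat 1"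
    by (simp add: matrix_mul_assoc frame_gram sign_matrix_square)
  then have "(g ** transpose frame_matrix ** sign_matrix) ** frame_matrix = mat 1"
    by (rule matrix_left_right_inverse1)
  then have gh: "g ** ?h = mat 1"
    by (simp add: matrix_mul_assoc)
  then have hg: "?h ** g = mat 1"
    by (rule matrix_left_right_inverse1)
  have inv: "g ** matrix_inv g = mat 1 \<and> matrix_inv g ** g = mat 1"
    unfolding matrix_inv_def by (rule someI[of _ ?h]) (use gh hg in simp)
  then show "matrix_inv g ** g = mat 1" by simp
  have "matrix_inv g = ?h ** g ** matrix_inv g" by (simp add: hg)
  also have "\<dots> = ?h ** (g ** matrix_inv g)" by (rule matrix_mul_assoc[symmetric])
  also have "\<dots> = ?h" using inv by simp
  finally show "matrix_inv g = ?h" .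
qed

text \<open>The product in \<open>metric_inverse\<close>, written in components. This is what turns
  every contraction with the inverse metric into a signed sum over frame indices.\<close>

lemma completeness: "ginv g \<alpha> \<beta> = (\<Sum>i\<in>UNIV. causal_sign i * (e i $ \<alpha> * e i $ \<beta>))"
proof -
  have "(transpose frame_matrix ** sign_matrix) $ \<alpha> $ i = causal_sign i * e i $ \<alpha>" for i
    by (simp add: matrix_matrix_mult_def transpose_def sign_matrix_def frame_matrix_def mult_delta_right)
  then show ?thesis
    unfolding metric_inverse by (simp add: matrix_matrix_mult_def[of "_ ** _"] frame_matrix_def mult_ac)
qed

text \<open>Determinants in \<open>E g E^T = S\<close>, where \<open>det S = -1\<close>. Up to sign,
  the frame determinant cancels the density factor of the volume element.\<close>

lemma det_frame: "\<bar>det frame_matrix\<bar> * sqrt \<bar>det g\<bar> = 1"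
proof -
  have "det sign_matrix = (\<Prod>i\<in>UNIV. sign_matrix $ i $ i)"
    by (rule det_diagonal) (simp add: sign_matrix_def)
  then have "det sign_matrix = -1"
    by (subst (asm) UNIV_index4) (simp add: sign_matrix_def)
  moreover have "det (frame_matrix ** g ** transpose frame_matrix) = det frame_matrix * det g * det frame_matrix"
    by (simp add: det_mul)
  ultimately have "det frame_matrix * det g * det frame_matrix = -1"
    by (simp add: frame_gram)
  then have "\<bar>det frame_matrix * det g * det frame_matrix\<bar> = 1" by simp
  then have "\<bar>det frame_matrix\<bar>\<^sup>2 * \<bar>det g\<bar> = 1"
    by (simp add: abs_mult power2_eq_square mult_ac)
  then have "sqrt (\<bar>det frame_matrix\<bar>\<^sup>2 * \<bar>det g\<bar>) = 1" by simp
  then show ?thesis by (simp add: real_sqrt_mult)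
qed

lemma contraction:
  fixes f h :: "4 \<Rightarrow> real"
  shows "(\<Sum>\<rho>\<in>UNIV. \<Sum>\<rho>'\<in>UNIV. ginv g \<rho> \<rho>' * (f \<rho> * h \<rho>')) =
    (\<Sum>r\<in>UNIV. causal_sign r * (frame_comp e f r * frame_comp e h r))"
proof -
  have "(\<Sum>\<rho>\<in>UNIV. \<Sum>\<rho>'\<in>UNIV. ginv g \<rho> \<rho>' * (f \<rho> * h \<rho>')) =
      (\<Sum>\<rho>\<in>UNIV. \<Sum>\<rho>'\<in>UNIV. \<Sum>r\<in>UNIV. causal_sign r * ((e r $ \<rho> * f \<rho>) * (e r $ \<rho>' * h \<rho>')))"
    by (simp add: completeness sum_distrib_left sum_distrib_right mult_ac)
  also have "\<dots> = (\<Sum>\<rho>\<in>UNIV. \<Sum>r\<in>UNIV. \<Sum>\<rho>'\<in>UNIV. causal_sign r * ((e r $ \<rho> * f \<rho>) * (e r $ \<rho>' * h \<rho>')))"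
    by (rule sum.cong[OF refl], rule sum.swap)
  also have "\<dots> = (\<Sum>r\<in>UNIV. \<Sum>\<rho>\<in>UNIV. \<Sum>\<rho>'\<in>UNIV. causal_sign r * ((e r $ \<rho> * f \<rho>) * (e r $ \<rho>' * h \<rho>')))"
    by (rule sum.swap)
  also have "\<dots> = (\<Sum>r\<in>UNIV. causal_sign r * (frame_comp e f r * frame_comp e h r))"
    by (simp only: frame_comp_def real_scaleR_def sum_product sum_distrib_left[of "causal_sign r" for r])
  finally show ?thesis .
qed

text \<open>The covectors \<open>causal_sign i * g(e i, _)\<close> form the dual basis, by
  completeness applied to the product of \<open>matrix_inv g\<close> and \<open>g\<close>. Hence
  \<open>f\<close> is a linear combination of its frame components.\<close>

lemma frame_comp_eq_zero:
  assumes "\<And>i. frame_comp e f i = 0"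
  shows "f \<alpha> = 0"
proof -
  have "(\<Sum>i\<in>UNIV. causal_sign i * (\<Sum>\<beta>\<in>UNIV. e i $ \<beta> * g $ \<beta> $ \<alpha>) * e i $ \<gamma>) = (if \<gamma> = \<alpha> then 1 else 0)" for \<gamma>
  proof -
    have "(matrix_inv g ** g) $ \<gamma> $ \<alpha> = (\<Sum>\<beta>\<in>UNIV. \<Sum>i\<in>UNIV. causal_sign i * (e i $ \<gamma> * e i $ \<beta>) * g $ \<beta> $ \<alpha>)"
      by (simp add: matrix_matrix_mult_def completeness sum_distrib_right)
    also have "\<dots> = (\<Sum>i\<in>UNIV. \<Sum>\<beta>\<in>UNIV. causal_sign i * (e i $ \<gamma> * e i $ \<beta>) * g $ \<beta> $ \<alpha>)"
      by (rule sum.swap)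
    finally show ?thesis
      by (simp add: metric_matrix_inv mat_def sum_distrib_left sum_distrib_right mult_ac)
  qed
  moreover have "f \<alpha> = (\<Sum>\<gamma>\<in>UNIV. (if \<gamma> = \<alpha> then 1 else 0) *\<^sub>R f \<gamma>)"
    by (simp add: if_distrib[of "\<lambda>c. c *\<^sub>R f _"] cong: if_cong)
  ultimately have "f \<alpha> = (\<Sum>\<gamma>\<in>UNIV. (\<Sum>i\<in>UNIV. causal_sign i * (\<Sum>\<beta>\<in>UNIV. e i $ \<beta> * g $ \<beta> $ \<alpha>) * e i $ \<gamma>) *\<^sub>R f \<gamma>)"
    by (simp only:)
  also have "\<dots> = (\<Sum>i\<in>UNIV. (causal_sign i * (\<Sum>\<beta>\<in>UNIV. e i $ \<beta> * g $ \<beta> $ \<alpha>)) *\<^sub>R frame_comp e f i)"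
    unfolding frame_comp_def scaleR_sum_right scaleR_sum_left
    by (subst sum.swap) simp
  finally show ?thesis by (simp add: assms)
qed

end

section \<open>Frame components of tensors\<close>

definition frame_comp2 :: "(4 \<Rightarrow> real^4) \<Rightarrow> (4 \<Rightarrow> 4 \<Rightarrow> 'a::real_algebra_1) \<Rightarrow> 4 \<Rightarrow> 4 \<Rightarrow> 'a" where
  "frame_comp2 e F i j = frame_comp e (\<lambda>\<alpha>. frame_comp e (F \<alpha>) j) i"

definition frame_comp4 :: "(4 \<Rightarrow> real^4) \<Rightarrow> 'a::real_algebra_1 tensor4 \<Rightarrow> 'a tensor4" where
  "frame_comp4 e A i j k l = frame_comp2 e (\<lambda>\<alpha> \<beta>. frame_comp2 e (A \<alpha> \<beta>) k l) i j"

lemma frame_comp2_flip: "frame_comp2 e (\<lambda>\<alpha> \<beta>. F \<beta> \<alpha>) i j = frame_comp2 e F j i"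
  unfolding frame_comp2_def by (rule frame_comp_swap)

text \<open>In \<open>bel_contr\<close> the summed slots are the second and fourth, so they have to
  be grouped together before a contraction can be evaluated.\<close>

lemma frame_comp4_interleave:
  "frame_comp2 e (\<lambda>\<alpha> \<beta>. frame_comp2 e (\<lambda>\<rho> \<sigma>. A \<alpha> \<rho> \<beta> \<sigma>) m n) i k = frame_comp4 e A i m k n"
  unfolding frame_comp4_def frame_comp2_def by (subst (2) frame_comp_swap) (rule refl)

lemma frame_comp2_exchange:
  "frame_comp2 e (\<lambda>\<mu> \<nu>. frame_comp2 e (\<lambda>\<rho> \<sigma>. W \<rho> \<sigma> \<mu> \<nu>) m n) k l =
    frame_comp2 e (\<lambda>\<rho> \<sigma>. frame_comp2 e (W \<rho> \<sigma>) k l) m n"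
proof -
  have "frame_comp2 e (\<lambda>\<mu> \<nu>. frame_comp2 e (\<lambda>\<rho> \<sigma>. W \<rho> \<sigma> \<mu> \<nu>) m n) k l =
      frame_comp e (\<lambda>\<mu>. frame_comp e (\<lambda>\<rho>. frame_comp e (\<lambda>\<nu>. frame_comp e (\<lambda>\<sigma>. W \<rho> \<sigma> \<mu> \<nu>) n) l) m) k"
    unfolding frame_comp2_def by (subst (2) frame_comp_swap) (rule refl)
  also have "\<dots> = frame_comp e (\<lambda>\<rho>. frame_comp e (\<lambda>\<mu>. frame_comp e (\<lambda>\<nu>. frame_comp e (\<lambda>\<sigma>. W \<rho> \<sigma> \<mu> \<nu>) n) l) k) m"
    by (rule frame_comp_swap)
  also have "\<dots> = frame_comp e (\<lambda>\<rho>. frame_comp e (\<lambda>\<mu>. frame_comp e (\<lambda>\<sigma>. frame_comp e (\<lambda>\<nu>. W \<rho> \<sigma> \<mu> \<nu>) l) n) k) m"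
    by (subst (3) frame_comp_swap) (rule refl)
  also have "\<dots> = frame_comp e (\<lambda>\<rho>. frame_comp e (\<lambda>\<sigma>. frame_comp e (\<lambda>\<mu>. frame_comp e (\<lambda>\<nu>. W \<rho> \<sigma> \<mu> \<nu>) l) k) n) m"
    by (subst (2) frame_comp_swap) (rule refl)
  finally show ?thesis
    by (simp add: frame_comp2_def)
qed

section \<open>The permutation symbol and the volume element in a frame\<close>

definition rows_det :: "real^4 \<Rightarrow> real^4 \<Rightarrow> real^4 \<Rightarrow> real^4 \<Rightarrow> real" where
  "rows_det a b c d = det (\<chi> i. if i = 0 then a else if i = 1 then b else if i = 2 then c else d)"

lemma levi_civita_eq_rows_det:
  "levi_civita \<alpha> \<beta> \<gamma> \<delta> = rows_det (axis \<alpha> 1) (axis \<beta> 1) (axis \<gamma> 1) (axis \<delta> 1)"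
  unfolding levi_civita_def rows_det_def by (rule arg_cong[of _ _ det]) (simp add: vec_eq_iff)

lemma det_row_expand:
  fixes x :: "real^4"
  shows "(\<Sum>\<alpha>\<in>UNIV. x $ \<alpha> * det (\<chi> i. if i = k then axis \<alpha> 1 else c i)) =
    det (\<chi> i. if i = k then x else c i)"
proof -
  have "det (\<chi> i. if i = k then x else c i) =
      det (\<chi> i. if i = k then (\<Sum>\<alpha>\<in>UNIV. x $ \<alpha> *s axis \<alpha> 1) else c i)"
    by (simp only: basis_expansion)
  then show ?thesis
    by (simp add: det_linear_row_sum det_row_mul)
qed

text \<open>\<open>rows_det\<close> is the multilinear extension of the permutation symbol from
  basis vectors to arbitrary rows; these are its four linear slots.\<close>

lemma rows_det_expand:
  "(\<Sum>\<alpha>\<in>UNIV. x $ \<alpha> * rows_det (axis \<alpha> 1) b c d) = rows_det x b c d"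
  "(\<Sum>\<alpha>\<in>UNIV. x $ \<alpha> * rows_det a (axis \<alpha> 1) c d) = rows_det a x c d"
  "(\<Sum>\<alpha>\<in>UNIV. x $ \<alpha> * rows_det a b (axis \<alpha> 1) d) = rows_det a b x d"
  "(\<Sum>\<alpha>\<in>UNIV. x $ \<alpha> * rows_det a b c (axis \<alpha> 1)) = rows_det a b c x"
proof -
  \<comment> \<open>In each reformulation the varying row is tested first, the shape in which
    \<open>det_row_expand\<close> applies.\<close>
  have 1: "rows_det y b c d = det (\<chi> i. if i = 0 then y else if i = 1 then b else if i = 2 then c else d)" for y
    by (simp add: rows_det_def)
  have 2: "rows_det a y c d = det (\<chi> i. if i = 1 then y else if i = 0 then a else if i = 2 then c else d)" for y
    unfolding rows_det_def by (rule arg_cong[of _ _ det]) (simp add: vec_eq_iff)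
  have 3: "rows_det a b y d = det (\<chi> i. if i = 2 then y else if i = 0 then a else if i = 1 then b else d)" for y
    unfolding rows_det_def by (rule arg_cong[of _ _ det]) (simp add: vec_eq_iff)
  have 4: "rows_det a b c y = det (\<chi> i. if i = 3 then y else if i = 0 then a else if i = 1 then b else c)" for y
    unfolding rows_det_def by (rule arg_cong[of _ _ det]) (use index4_cases in \<open>auto simp: vec_eq_iff\<close>)
  show "(\<Sum>\<alpha>\<in>UNIV. x $ \<alpha> * rows_det (axis \<alpha> 1) b c d) = rows_det x b c d"
    unfolding 1 by (rule det_row_expand)
  show "(\<Sum>\<alpha>\<in>UNIV. x $ \<alpha> * rows_det a (axis \<alpha> 1) c d) = rows_det a x c d"
    unfolding 2 by (rule det_row_expand)
  show "(\<Sum>\<alpha>\<in>UNIV. x $ \<alpha> * rows_det a b (axis \<alpha> 1) d) = rows_det a b x d"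
    unfolding 3 by (rule det_row_expand)
  show "(\<Sum>\<alpha>\<in>UNIV. x $ \<alpha> * rows_det a b c (axis \<alpha> 1)) = rows_det a b c x"
    unfolding 4 by (rule det_row_expand)
qed

text \<open>By multilinearity the left side is the determinant with rows
  \<open>e i, e j, e k, e l\<close>, and that matrix is a row-selection matrix times the frame
  matrix.\<close>

lemma frame_comp4_levi_civita:
  "frame_comp4 e levi_civita i j k l = levi_civita i j k l * det (\<chi> r \<alpha>. e r $ \<alpha>)"
proof -
  have "frame_comp4 e levi_civita i j k l = rows_det (e i) (e j) (e k) (e l)"
    by (simp add: frame_comp4_def frame_comp2_def frame_comp_def levi_civita_eq_rows_det rows_det_expand)
  also have "\<dots> = det ((\<chi> r. axis (if r = 0 then i else if r = 1 then j else if r = 2 then k else l) 1)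
      ** (\<chi> r \<alpha>. e r $ \<alpha>))"
    unfolding rows_det_def
    by (rule arg_cong[of _ _ det])
      (simp add: vec_eq_iff matrix_matrix_mult_def axis_def mult_delta_left)
  finally show ?thesis
    by (simp add: det_mul levi_civita_def)
qed

lemma levi_civita_swap:
  "levi_civita b a c d = - levi_civita a b c d"
  "levi_civita a c b d = - levi_civita a b c d"
  "levi_civita a b d c = - levi_civita a b c d"
proof -
  let ?M = "\<lambda>a b c d. (\<chi> i. axis (if i = 0 then a else if i = 1 then b else if i = 2 then c else d) 1 :: real^4^4)"
  have swap: "det (\<chi> i. ?M a b c d $ Transposition.transpose r s i) = - det (?M a b c d)" if "r \<noteq> s" for r s
    using that by (subst det_permute_rows) (simp_all add: permutes_swap_id sign_swap_id)
  have "?M b a c d = (\<chi> i. ?M a b c d $ Transposition.transpose 0 1 i)"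
    by (auto simp: vec_eq_iff Transposition.transpose_def)
  then show "levi_civita b a c d = - levi_civita a b c d"
    using swap[of 0 1] by (simp add: levi_civita_def)
  have "?M a c b d = (\<chi> i. ?M a b c d $ Transposition.transpose 1 2 i)"
    by (auto simp: vec_eq_iff Transposition.transpose_def)
  then show "levi_civita a c b d = - levi_civita a b c d"
    using swap[of 1 2] by (simp add: levi_civita_def)
  have "?M a b d c = (\<chi> i. ?M a b c d $ Transposition.transpose 2 3 i)"
    using index4_cases by (auto simp: vec_eq_iff Transposition.transpose_def)
  then show "levi_civita a b d c = - levi_civita a b c d"
    using swap[of 2 3] by (simp add: levi_civita_def)
qed

lemma levi_civita_repeated [simp]:
  "levi_civita a a c d = 0" "levi_civita a b a d = 0" "levi_civita a b c a = 0"
  "levi_civita a b b d = 0" "levi_civita a b c b = 0" "levi_civita a b c c = 0"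
proof -
  show 1: "levi_civita a a c d = 0" for a c d using levi_civita_swap(1)[of a a c d] by simp
  show 2: "levi_civita a b b d = 0" for a b d using levi_civita_swap(2)[of a b b d] by simp
  show 3: "levi_civita a b c c = 0" for a b c using levi_civita_swap(3)[of a b c c] by simp
  show "levi_civita a b a d = 0" using levi_civita_swap(1)[of a b a d] 2[of b a d] by simp
  show 4: "levi_civita a b c b = 0" for a b c using levi_civita_swap(2)[of a c b b] 3[of a c b] by simp
  show "levi_civita a b c a = 0" using levi_civita_swap(1)[of a b c a] 4[of b a c] by simp
qed

lemma levi_civita_0123: "levi_civita 0 1 2 3 = 1"
proof -
  have "(\<chi> i. axis (if i = 0 then 0 else if i = 1 then 1 else if i = 2 then 2 else 3) 1 :: real^4^4) = mat 1"
    using index4_cases by (auto simp: vec_eq_iff axis_def mat_def)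
  then show ?thesis
    by (simp add: levi_civita_def)
qed

lemma levi_civita_values:
  "levi_civita 0 1 2 3 = 1" "levi_civita 0 1 3 2 = -1"
  "levi_civita 0 2 3 1 = 1" "levi_civita 0 2 1 3 = -1"
  "levi_civita 0 3 1 2 = 1" "levi_civita 0 3 2 1 = -1"
  "levi_civita 2 3 0 1 = 1" "levi_civita 2 3 1 0 = -1"
  "levi_civita 3 1 0 2 = 1" "levi_civita 3 1 2 0 = -1"
  "levi_civita 1 2 0 3 = 1" "levi_civita 1 2 3 0 = -1"
proof -
  note s = levi_civita_swap
  show a: "levi_civita 0 1 2 3 = 1" by (rule levi_civita_0123)
  show a': "levi_civita 0 1 3 2 = -1" using a s(3)[of 0 1 3 2] by simp
  show b': "levi_civita 0 2 1 3 = -1" using a s(2)[of 0 2 1 3] by simp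
  show b: "levi_civita 0 2 3 1 = 1" using b' s(3)[of 0 2 3 1] by simp
  show c: "levi_civita 0 3 1 2 = 1" using a' s(2)[of 0 3 1 2] by simp
  show c': "levi_civita 0 3 2 1 = -1" using c s(3)[of 0 3 2 1] by simp
  show d: "levi_civita 2 3 0 1 = 1" using b s(1)[of 2 0 3 1] s(2)[of 2 3 0 1] by simp
  show "levi_civita 2 3 1 0 = -1" using d s(3)[of 2 3 1 0] by simp
  show f: "levi_civita 3 1 0 2 = 1" using c s(1)[of 3 0 1 2] s(2)[of 3 1 0 2] by simp
  show "levi_civita 3 1 2 0 = -1" using f s(3)[of 3 1 2 0] by simp
  show h: "levi_civita 1 2 0 3 = 1" using a s(1)[of 1 0 2 3] s(2)[of 1 2 0 3] by simp
  show "levi_civita 1 2 3 0 = -1" using h s(3)[of 1 2 3 0] by simp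
qed

context orthonormal_frame
begin

text \<open>The density factor cancels against the frame determinant by \<open>det_frame\<close>.
  The remaining sign combines the chosen orientation with that of the frame.\<close>

lemma frame_comp4_volume_element:
  assumes "volume_element g \<eta>"
  obtains s where "s = 1 \<or> s = -1" "\<And>i j k l. frame_comp4 e \<eta> i j k l = s * levi_civita i j k l"
proof -
  obtain r where "r \<in> {1, -1}"
    and "\<forall>\<alpha> \<beta> \<gamma> \<delta>. \<eta> \<alpha> \<beta> \<gamma> \<delta> = r * sqrt \<bar>det g\<bar> * levi_civita \<alpha> \<beta> \<gamma> \<delta>"
    using assms unfolding volume_element_def by blast
  then have r: "r = 1 \<or> r = -1"
    and \<eta>: "\<eta> = (\<lambda>\<alpha> \<beta> \<gamma> \<delta>. r * sqrt \<bar>det g\<bar> * levi_civita \<alpha> \<beta> \<gamma> \<delta>)"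
    by (auto simp: fun_eq_iff)
  let ?s = "r * (sqrt \<bar>det g\<bar> * det frame_matrix)"
  have "frame_comp4 e \<eta> i j k l = ?s * levi_civita i j k l" for i j k l
  proof -
    have "frame_comp4 e \<eta> i j k l = r * sqrt \<bar>det g\<bar> * frame_comp4 e levi_civita i j k l"
      by (simp add: \<eta> frame_comp4_def frame_comp2_def frame_comp_mult_left)
    then show ?thesis
      by (simp add: frame_comp4_levi_civita frame_matrix_def)
  qed
  moreover have "?s = 1 \<or> ?s = -1"
  proof -
    have "\<bar>sqrt \<bar>det g\<bar> * det frame_matrix\<bar> = 1"
      using det_frame by (simp add: abs_mult mult.commute)
    then show ?thesis using r by auto
  qed
  ultimately show ?thesis using that by blast
qed

text \<open>\<open>contraction\<close> applied to the inner and then to the outer pair of indices;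
  the other steps reorder sums. The duals, the Bel-Robinson contraction and the tensor square are
  all brought to this pattern.\<close>

lemma contraction2:
  fixes f h :: "real tensor2"
  shows "(\<Sum>\<mu>\<in>UNIV. \<Sum>\<nu>\<in>UNIV. \<Sum>\<rho>\<in>UNIV. \<Sum>\<sigma>\<in>UNIV.
      ginv g \<mu> \<rho> * (ginv g \<nu> \<sigma> * (f \<mu> \<nu> * h \<rho> \<sigma>))) =
    (\<Sum>m\<in>UNIV. \<Sum>n\<in>UNIV. causal_sign m * (causal_sign n * (frame_comp2 e f m n * frame_comp2 e h m n)))"
proof -
  have "(\<Sum>\<mu>\<in>UNIV. \<Sum>\<nu>\<in>UNIV. \<Sum>\<rho>\<in>UNIV. \<Sum>\<sigma>\<in>UNIV.
      ginv g \<mu> \<rho> * (ginv g \<nu> \<sigma> * (f \<mu> \<nu> * h \<rho> \<sigma>))) =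
    (\<Sum>\<mu>\<in>UNIV. \<Sum>\<rho>\<in>UNIV. \<Sum>\<nu>\<in>UNIV. \<Sum>\<sigma>\<in>UNIV.
      ginv g \<mu> \<rho> * (ginv g \<nu> \<sigma> * (f \<mu> \<nu> * h \<rho> \<sigma>)))"
    by (rule sum.cong[OF refl], rule sum.swap)
  also have "\<dots> = (\<Sum>\<mu>\<in>UNIV. \<Sum>\<rho>\<in>UNIV. ginv g \<mu> \<rho> *
      (\<Sum>n\<in>UNIV. causal_sign n * (frame_comp e (f \<mu>) n * frame_comp e (h \<rho>) n)))"
    by (simp only: contraction flip: sum_distrib_left)
  also have "\<dots> = (\<Sum>\<mu>\<in>UNIV. \<Sum>\<rho>\<in>UNIV. \<Sum>n\<in>UNIV. causal_sign n *
      (ginv g \<mu> \<rho> * (frame_comp e (f \<mu>) n * frame_comp e (h \<rho>) n)))"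
    by (simp only: sum_distrib_left mult.left_commute)
  also have "\<dots> = (\<Sum>\<mu>\<in>UNIV. \<Sum>n\<in>UNIV. \<Sum>\<rho>\<in>UNIV. causal_sign n *
      (ginv g \<mu> \<rho> * (frame_comp e (f \<mu>) n * frame_comp e (h \<rho>) n)))"
    by (rule sum.cong[OF refl], rule sum.swap)
  also have "\<dots> = (\<Sum>n\<in>UNIV. \<Sum>\<mu>\<in>UNIV. \<Sum>\<rho>\<in>UNIV. causal_sign n *
      (ginv g \<mu> \<rho> * (frame_comp e (f \<mu>) n * frame_comp e (h \<rho>) n)))"
    by (rule sum.swap)
  also have "\<dots> = (\<Sum>n\<in>UNIV. causal_sign n * (\<Sum>\<mu>\<in>UNIV. \<Sum>\<rho>\<in>UNIV.
      ginv g \<mu> \<rho> * (frame_comp e (f \<mu>) n * frame_comp e (h \<rho>) n)))"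
    by (simp only: sum_distrib_left)
  also have "\<dots> = (\<Sum>n\<in>UNIV. causal_sign n * (\<Sum>m\<in>UNIV.
      causal_sign m * (frame_comp2 e f m n * frame_comp2 e h m n)))"
    unfolding frame_comp2_def contraction ..
  also have "\<dots> = (\<Sum>n\<in>UNIV. \<Sum>m\<in>UNIV.
      causal_sign m * (causal_sign n * (frame_comp2 e f m n * frame_comp2 e h m n)))"
    by (simp only: sum_distrib_left mult.left_commute)
  also have "\<dots> = (\<Sum>m\<in>UNIV. \<Sum>n\<in>UNIV.
      causal_sign m * (causal_sign n * (frame_comp2 e f m n * frame_comp2 e h m n)))"
    by (rule sum.swap)
  finally show ?thesis .
qed

lemma frame_comp2_hodge2:
  "frame_comp2 e (hodge2 g \<eta> F) i j = (1/2) * (\<Sum>m\<in>UNIV. \<Sum>n\<in>UNIV.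
     causal_sign m * (causal_sign n * (frame_comp4 e \<eta> i j m n * frame_comp2 e F m n)))"
proof -
  have "hodge2 g \<eta> F = (\<lambda>\<alpha> \<beta>. (1/2) * (\<Sum>m\<in>UNIV. \<Sum>n\<in>UNIV.
     causal_sign m * (causal_sign n * (frame_comp2 e (\<eta> \<alpha> \<beta>) m n * frame_comp2 e F m n))))"
    unfolding contraction2[symmetric]
    by (simp add: fun_eq_iff hodge2_def raise2_def sum_distrib_left mult_ac)
  then show ?thesis
    by (simp only: frame_comp_linear frame_comp2_def frame_comp4_def)
qed

lemma frame_comp4_hodge_double:
  "frame_comp4 e (hodge_double g \<eta> W) i j k l = (1/2) * (\<Sum>m\<in>UNIV. \<Sum>n\<in>UNIV.
     causal_sign m * (causal_sign n * (frame_comp4 e \<eta> i j m n * frame_comp4 e W m n k l)))"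
proof -
  have "hodge_double g \<eta> W = (\<lambda>\<alpha> \<beta> \<mu> \<nu>. (1/2) * (\<Sum>m\<in>UNIV. \<Sum>n\<in>UNIV.
     causal_sign m * (causal_sign n * (frame_comp2 e (\<eta> \<alpha> \<beta>) m n * frame_comp2 e (\<lambda>\<rho> \<sigma>. W \<rho> \<sigma> \<mu> \<nu>) m n))))"
    unfolding contraction2[symmetric]
    by (simp add: fun_eq_iff hodge_double_def hodge2_def raise2_def sum_distrib_left mult_ac)
  moreover have "frame_comp2 e (\<lambda>\<mu> \<nu>. frame_comp2 e (\<lambda>\<rho> \<sigma>. W \<rho> \<sigma> \<mu> \<nu>) m n) k l = frame_comp4 e W m n k l" for m n
    unfolding frame_comp4_def by (rule frame_comp2_exchange)
  ultimately show ?thesis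
    by (simp only: frame_comp_linear frame_comp2_def frame_comp4_def)
qed

lemma frame_comp4_bel_contr:
  fixes A B :: "real tensor4"
  shows "frame_comp4 e (bel_contr g A B) i j k l = (\<Sum>m\<in>UNIV. \<Sum>n\<in>UNIV.
    causal_sign m * (causal_sign n * (frame_comp4 e B j m l n * frame_comp4 e A i m k n)))"
proof -
  have "bel_contr g A B = (\<lambda>\<alpha> \<mu> \<beta> \<nu>. (\<Sum>m\<in>UNIV. \<Sum>n\<in>UNIV.
     causal_sign m * (causal_sign n * (frame_comp2 e (\<lambda>\<rho> \<sigma>. B \<mu> \<rho> \<nu> \<sigma>) m n *
       frame_comp2 e (\<lambda>\<rho> \<sigma>. A \<alpha> \<rho> \<beta> \<sigma>) m n))))"
    unfolding contraction2[symmetric]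
    by (simp add: fun_eq_iff bel_contr_def mult_ac)
  then show ?thesis
    unfolding frame_comp4_interleave[symmetric]
    by (simp only: frame_comp_linear frame_comp2_def frame_comp4_def)
qed

lemma frame_comp4_tensor4_square:
  "frame_comp4 e (tensor4_square g T) i j k l = (\<Sum>m\<in>UNIV. \<Sum>n\<in>UNIV.
    causal_sign m * (causal_sign n * (frame_comp4 e T i j m n * frame_comp4 e T m n k l)))"
proof -
  have "tensor4_square g T = (\<lambda>\<alpha> \<beta> \<kappa> \<tau>. (\<Sum>m\<in>UNIV. \<Sum>n\<in>UNIV.
     causal_sign m * (causal_sign n * (frame_comp2 e (\<lambda>\<mu> \<nu>. T \<mu> \<nu> \<kappa> \<tau>) m n * frame_comp2 e (T \<alpha> \<beta>) m n))))"
    unfolding contraction2[symmetric]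
    by (simp add: fun_eq_iff tensor4_square_def raise2_def sum_distrib_left mult_ac)
  moreover have "frame_comp2 e (\<lambda>\<kappa> \<tau>. frame_comp2 e (\<lambda>\<mu> \<nu>. T \<mu> \<nu> \<kappa> \<tau>) m n) k l = frame_comp4 e T m n k l" for m n
    unfolding frame_comp4_def by (rule frame_comp2_exchange)
  ultimately show ?thesis
    by (simp only: frame_comp_linear frame_comp2_def frame_comp4_def mult.commute[of "frame_comp e _ i"])
qed

lemma trace_contraction:
  fixes F :: "real tensor2"
  shows "(\<Sum>\<alpha>\<in>UNIV. \<Sum>\<beta>\<in>UNIV. ginv g \<alpha> \<beta> * F \<alpha> \<beta>) = (\<Sum>m\<in>UNIV. causal_sign m * frame_comp2 e F m m)"
proof -
  have "(\<Sum>\<alpha>\<in>UNIV. \<Sum>\<beta>\<in>UNIV. ginv g \<alpha> \<beta> * F \<alpha> \<beta>) =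
      (\<Sum>\<alpha>\<in>UNIV. \<Sum>\<beta>\<in>UNIV. \<Sum>m\<in>UNIV. causal_sign m * (e m $ \<alpha> * (e m $ \<beta> * F \<alpha> \<beta>)))"
    by (simp add: completeness sum_distrib_left sum_distrib_right mult_ac)
  also have "\<dots> = (\<Sum>\<alpha>\<in>UNIV. \<Sum>m\<in>UNIV. \<Sum>\<beta>\<in>UNIV. causal_sign m * (e m $ \<alpha> * (e m $ \<beta> * F \<alpha> \<beta>)))"
    by (rule sum.cong[OF refl], rule sum.swap)
  also have "\<dots> = (\<Sum>m\<in>UNIV. \<Sum>\<alpha>\<in>UNIV. \<Sum>\<beta>\<in>UNIV. causal_sign m * (e m $ \<alpha> * (e m $ \<beta> * F \<alpha> \<beta>)))"
    by (rule sum.swap)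
  finally show ?thesis
    by (simp add: frame_comp2_def frame_comp_def sum_distrib_left)
qed

section \<open>Weyl symmetries in frame components\<close>

lemma frame_comp4_weyl:
  assumes "weyl_tensor g W"
  defines "w \<equiv> frame_comp4 e W"
  shows "w j i k l = - w i j k l" "w i j l k = - w i j k l" "w k l i j = w i j k l"
    "w i j k l + w i k l j + w i l j k = 0" "(\<Sum>m\<in>UNIV. causal_sign m * w m j m l) = 0"
proof -
  have W: "W \<beta> \<alpha> \<mu> \<nu> = - W \<alpha> \<beta> \<mu> \<nu>" "W \<alpha> \<beta> \<nu> \<mu> = - W \<alpha> \<beta> \<mu> \<nu>" "W \<mu> \<nu> \<alpha> \<beta> = W \<alpha> \<beta> \<mu> \<nu>"
    "W \<alpha> \<beta> \<mu> \<nu> + W \<alpha> \<mu> \<nu> \<beta> + W \<alpha> \<nu> \<beta> \<mu> = 0"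
    "(\<Sum>\<alpha>\<in>UNIV. \<Sum>\<mu>\<in>UNIV. ginv g \<alpha> \<mu> * W \<alpha> \<beta> \<mu> \<nu>) = 0" for \<alpha> \<beta> \<mu> \<nu>
    using assms(1) unfolding weyl_tensor_def by blast+
  show 1: "w j i k l = - w i j k l" for i j k l
  proof -
    have "w j i k l = frame_comp2 e (\<lambda>\<alpha> \<beta>. frame_comp2 e (W \<beta> \<alpha>) k l) i j"
      unfolding w_def frame_comp4_def by (rule frame_comp2_flip[symmetric])
    also have "\<dots> = - w i j k l"
      by (subst W(1)[abs_def]) (simp add: w_def frame_comp4_def frame_comp2_def frame_comp_minus)
    finally show ?thesis .
  qed
  show 3: "w k l i j = w i j k l" for i j k l
    unfolding w_def frame_comp4_def by (subst W(3)[abs_def]) (rule frame_comp2_exchange)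
  show "w i j l k = - w i j k l"
    by (subst (1 2) 3) (rule 1)
  show "w i j k l + w i k l j + w i l j k = 0"
  proof -
    \<comment> \<open>A cyclic permutation of three slots is two exchanges of neighbouring
      slots.\<close>
    have rot: "frame_comp e (\<lambda>a. frame_comp e (\<lambda>b. frame_comp e (\<lambda>c. G b c a) l) k) j =
      frame_comp e (\<lambda>b. frame_comp e (\<lambda>c. frame_comp e (\<lambda>a. G b c a) j) l) k" for G :: "real tensor3" and j k l
      by (subst frame_comp_swap, subst (2) frame_comp_swap) (rule refl)
    have "0 = frame_comp4 e (\<lambda>\<alpha> \<beta> \<mu> \<nu>. W \<alpha> \<beta> \<mu> \<nu> + W \<alpha> \<mu> \<nu> \<beta> + W \<alpha> \<nu> \<beta> \<mu>) i j k l"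
      by (simp add: W(4) frame_comp4_def frame_comp2_def frame_comp_zero)
    also have "\<dots> = w i j k l + frame_comp4 e (\<lambda>\<alpha> \<beta> \<mu> \<nu>. W \<alpha> \<mu> \<nu> \<beta>) i j k l + frame_comp4 e (\<lambda>\<alpha> \<beta> \<mu> \<nu>. W \<alpha> \<nu> \<beta> \<mu>) i j k l"
      by (simp add: w_def frame_comp4_def frame_comp2_def frame_comp_linear)
    also have "frame_comp4 e (\<lambda>\<alpha> \<beta> \<mu> \<nu>. W \<alpha> \<mu> \<nu> \<beta>) i j k l = w i k l j"
      unfolding w_def frame_comp4_def frame_comp2_def
      by (rule arg_cong[of _ _ "\<lambda>f. frame_comp e f i"], rule ext, rule rot)
    also have "frame_comp4 e (\<lambda>\<alpha> \<beta> \<mu> \<nu>. W \<alpha> \<nu> \<beta> \<mu>) i j k l = w i l j k"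
      unfolding w_def frame_comp4_def frame_comp2_def
      by (rule arg_cong[of _ _ "\<lambda>f. frame_comp e f i"], rule ext, rule rot[symmetric])
    finally show ?thesis by simp
  qed
  have "0 = frame_comp2 e (\<lambda>\<beta> \<nu>. \<Sum>\<alpha>\<in>UNIV. \<Sum>\<mu>\<in>UNIV. ginv g \<alpha> \<mu> * W \<alpha> \<beta> \<mu> \<nu>) j l"
    by (simp add: W(5) frame_comp2_def frame_comp_zero)
  also have "\<dots> = (\<Sum>m\<in>UNIV. causal_sign m *
      frame_comp2 e (\<lambda>\<beta> \<nu>. frame_comp2 e (\<lambda>\<alpha> \<mu>. W \<alpha> \<beta> \<mu> \<nu>) m m) j l)"
    by (simp only: trace_contraction frame_comp2_def frame_comp_linear)
  also have "\<dots> = (\<Sum>m\<in>UNIV. causal_sign m * w m j m l)"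
    unfolding w_def frame_comp4_interleave[symmetric]
    by (simp only: frame_comp2_exchange[of e "\<lambda>\<alpha> \<mu> \<beta> \<nu>. W \<alpha> \<beta> \<mu> \<nu>"])
  finally show "(\<Sum>m\<in>UNIV. causal_sign m * w m j m l) = 0" by simp
qed

section \<open>Vectors in a frame and the dual of a 3-form\<close>

lemma frame_comp_lower: "frame_comp e (lower g v) i = gprod g (e i) v"
  by (simp add: frame_comp_def lower_def gprod_def sum_distrib_left mult_ac)

lemma frame_comp2_wedge2:
  "frame_comp2 e (wedge2 g a b) i j =
    gprod g (e i) a * gprod g (e j) b - gprod g (e i) b * gprod g (e j) a"
  by (simp add: frame_comp2_def wedge2_def[abs_def] frame_comp_linear frame_comp_lower)

lemma gprod_raise1: "gprod g v (raise1 g a) = (\<Sum>\<alpha>\<in>UNIV. v $ \<alpha> * a \<alpha>)"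
proof -
  have "g ** matrix_inv g = mat 1"
    using metric_matrix_inv by (rule matrix_left_right_inverse1)
  then have "(g ** matrix_inv g) $ \<alpha> $ \<gamma> = (if \<alpha> = \<gamma> then 1 else 0)" for \<alpha> \<gamma>
    by (simp add: mat_def)
  then have inv: "(\<Sum>\<beta>\<in>UNIV. g $ \<alpha> $ \<beta> * ginv g \<beta> \<gamma>) = (if \<alpha> = \<gamma> then 1 else 0)" for \<alpha> \<gamma>
    by (simp add: matrix_matrix_mult_def)
  have "gprod g v (raise1 g a) = (\<Sum>\<alpha>\<in>UNIV. \<Sum>\<beta>\<in>UNIV. \<Sum>\<gamma>\<in>UNIV. (g $ \<alpha> $ \<beta> * ginv g \<beta> \<gamma>) * (v $ \<alpha> * a \<gamma>))"
    by (simp add: gprod_def raise1_def sum_distrib_left mult_ac)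
  also have "\<dots> = (\<Sum>\<alpha>\<in>UNIV. \<Sum>\<gamma>\<in>UNIV. \<Sum>\<beta>\<in>UNIV. (g $ \<alpha> $ \<beta> * ginv g \<beta> \<gamma>) * (v $ \<alpha> * a \<gamma>))"
    by (rule sum.cong[OF refl], rule sum.swap)
  also have "\<dots> = (\<Sum>\<alpha>\<in>UNIV. \<Sum>\<gamma>\<in>UNIV. (if \<alpha> = \<gamma> then 1 else 0) * (v $ \<alpha> * a \<gamma>))"
    by (simp only: inv flip: sum_distrib_right)
  finally show ?thesis
    by (simp add: mult_delta_left)
qed

end

lemma rows_det_repeated:
  "rows_det a a c d = 0" "rows_det a b a d = 0" "rows_det a b c a = 0"
proof -
  have rep: "det (A :: real^4^4) = 0" if "i \<noteq> j" "A $ i = A $ j" for A i j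
    using that det_identical_rows[of i j A] by (simp add: row_def)
  show "rows_det a a c d = 0" unfolding rows_det_def by (rule rep[of 0 1]) simp_all
  show "rows_det a b a d = 0" unfolding rows_det_def by (rule rep[of 0 2]) simp_all
  show "rows_det a b c a = 0" unfolding rows_det_def by (rule rep[of 0 3]) simp_all
qed

lemma levi_civita_contract:
  "(\<Sum>\<alpha>\<in>UNIV. \<Sum>\<kappa>\<in>UNIV. \<Sum>\<mu>\<in>UNIV. \<Sum>\<nu>\<in>UNIV.
     v $ \<alpha> * (a $ \<kappa> * (b $ \<mu> * (c $ \<nu> * levi_civita \<alpha> \<kappa> \<mu> \<nu>)))) = rows_det v a b c"
  by (simp add: levi_civita_eq_rows_det rows_det_expand flip: sum_distrib_left)

context orthonormal_frame
begin

lemma raise1_lower: "raise1 g (lower g v) = v"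
proof -
  have "raise1 g (lower g v) = (matrix_inv g ** g) *v v"
    unfolding matrix_vector_mul_assoc[symmetric]
    by (simp add: vec_eq_iff raise1_def lower_def matrix_vector_mult_def)
  then show ?thesis by (simp add: metric_matrix_inv)
qed

lemma ginv_lower: "(\<Sum>\<beta>\<in>UNIV. ginv g \<alpha> \<beta> * lower g v \<beta>) = v $ \<alpha>"
  using arg_cong[OF raise1_lower[of v], of "\<lambda>x. x $ \<alpha>"] by (simp add: raise1_def)

lemma gprod_frame:
  "gprod g a b = (\<Sum>i\<in>UNIV. causal_sign i * (gprod g (e i) a * gprod g (e i) b))"
proof -
  have "(\<Sum>\<alpha>\<in>UNIV. \<Sum>\<beta>\<in>UNIV. ginv g \<alpha> \<beta> * (lower g a \<alpha> * lower g b \<beta>)) =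
      (\<Sum>\<alpha>\<in>UNIV. lower g a \<alpha> * (\<Sum>\<beta>\<in>UNIV. ginv g \<alpha> \<beta> * lower g b \<beta>))"
    by (simp add: sum_distrib_left mult_ac)
  also have "\<dots> = gprod g b a"
    unfolding ginv_lower by (simp add: gprod_def lower_def sum_distrib_left sum_distrib_right mult_ac)
  also have "\<dots> = gprod g a b"
    by (rule gprod_sym[OF metric_sym])
  finally show ?thesis
    by (simp only: contraction frame_comp_lower)
qed

lemma eq_zero_of_frame:
  assumes "\<And>i. gprod g (e i) v = 0"
  shows "v = 0"
proof -
  have "lower g v \<alpha> = 0" for \<alpha>
    by (rule frame_comp_eq_zero) (simp add: frame_comp_lower assms)
  then have "raise1 g (lower g v) = 0"
    by (simp add: raise1_def vec_eq_iff)
  then show ?thesis by (simp add: raise1_lower)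
qed

lemma frame_comp4_ext:
  fixes A B :: "'a::real_algebra_1 tensor4"
  assumes "\<And>i j k l. frame_comp4 e A i j k l = frame_comp4 e B i j k l"
  shows "A = B"
proof -
  have eq: "f = h" if "\<And>i. frame_comp e f i = frame_comp e h i" for f h :: "4 \<Rightarrow> 'a"
  proof
    fix \<alpha>
    show "f \<alpha> = h \<alpha>"
      using frame_comp_eq_zero[of "\<lambda>\<alpha>. f \<alpha> - h \<alpha>" \<alpha>] by (simp add: frame_comp_diff that)
  qed
  have eq2: "F = H" if "\<And>i j. frame_comp2 e F i j = frame_comp2 e H i j" for F H :: "'a tensor2"
  proof (intro ext)
    fix \<alpha> \<beta>
    have "(\<lambda>\<alpha>. frame_comp e (F \<alpha>) j) = (\<lambda>\<alpha>. frame_comp e (H \<alpha>) j)" for j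
      by (rule eq) (use that in \<open>simp add: frame_comp2_def\<close>)
    then have "frame_comp e (F \<alpha>) j = frame_comp e (H \<alpha>) j" for j
      by (rule fun_cong)
    then show "F \<alpha> \<beta> = H \<alpha> \<beta>"
      using eq by metis
  qed
  show ?thesis
  proof (intro ext)
    fix \<alpha> \<beta> \<mu> \<nu>
    have "(\<lambda>\<alpha> \<beta>. frame_comp2 e (A \<alpha> \<beta>) k l) = (\<lambda>\<alpha> \<beta>. frame_comp2 e (B \<alpha> \<beta>) k l)" for k l
      by (rule eq2) (use assms in \<open>simp add: frame_comp4_def\<close>)
    then have "frame_comp2 e (A \<alpha> \<beta>) k l = frame_comp2 e (B \<alpha> \<beta>) k l" for k l
      by (metis (no_types))
    then have "A \<alpha> \<beta> = B \<alpha> \<beta>"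
      by (rule eq2)
    then show "A \<alpha> \<beta> \<mu> \<nu> = B \<alpha> \<beta> \<mu> \<nu>" by simp
  qed
qed

lemma raise3_tensor_product:
  "raise3 g (\<lambda>\<kappa> \<mu> \<nu>. lower g a \<kappa> * (lower g b \<mu> * lower g c \<nu>)) \<kappa> \<mu> \<nu> = a $ \<kappa> * (b $ \<mu> * c $ \<nu>)"
proof -
  have "raise3 g (\<lambda>\<kappa> \<mu> \<nu>. lower g a \<kappa> * (lower g b \<mu> * lower g c \<nu>)) \<kappa> \<mu> \<nu> =
      (\<Sum>\<tau>\<in>UNIV. ginv g \<kappa> \<tau> * lower g a \<tau>) * ((\<Sum>\<rho>\<in>UNIV. ginv g \<mu> \<rho> * lower g b \<rho>) *
        (\<Sum>\<sigma>\<in>UNIV. ginv g \<nu> \<sigma> * lower g c \<sigma>))"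
    unfolding raise3_def sum_product unfolding sum_distrib_left by (simp add: mult_ac)
  then show ?thesis by (simp only: ginv_lower)
qed

lemma raise3_wedge3:
  "raise3 g (wedge3 g a b c) \<kappa> \<mu> \<nu> =
     a $ \<kappa> * (b $ \<mu> * c $ \<nu>) - a $ \<kappa> * (c $ \<mu> * b $ \<nu>) + c $ \<kappa> * (a $ \<mu> * b $ \<nu>)
     - b $ \<kappa> * (a $ \<mu> * c $ \<nu>) + b $ \<kappa> * (c $ \<mu> * a $ \<nu>) - c $ \<kappa> * (b $ \<mu> * a $ \<nu>)"
  unfolding raise3_tensor_product[symmetric]
  by (simp add: raise3_def wedge3_def wedge2_def algebra_simps flip: sum.distrib sum_subtractf)

text \<open>The six determinants are the signed rearrangements of \<open>a, b, c\<close> in the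
  wedge product. The factor \<open>k\<close> may stay unspecified: the formula serves to show
  orthogonality, and \<open>x\<close> is normalised afterwards.\<close>

lemma gprod_hodge3_wedge3:
  assumes "volume_element g \<eta>"
  shows "\<exists>k. \<forall>v. gprod g v (hodge3 g \<eta> (wedge3 g a b c)) = k *
     (rows_det v a b c - rows_det v a c b + rows_det v c a b - rows_det v b a c + rows_det v b c a - rows_det v c b a)"
proof -
  obtain r where "\<forall>\<alpha> \<beta> \<gamma> \<delta>. \<eta> \<alpha> \<beta> \<gamma> \<delta> = r * sqrt \<bar>det g\<bar> * levi_civita \<alpha> \<beta> \<gamma> \<delta>"
    using assms unfolding volume_element_def by blast
  then obtain k where k: "\<eta> \<alpha> \<beta> \<gamma> \<delta> = k * levi_civita \<alpha> \<beta> \<gamma> \<delta>" for \<alpha> \<beta> \<gamma> \<delta>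
    by blast
  have "gprod g v (hodge3 g \<eta> (wedge3 g a b c)) = (k / 6) *
     (rows_det v a b c - rows_det v a c b + rows_det v c a b - rows_det v b a c + rows_det v b c a - rows_det v c b a)" for v
    unfolding levi_civita_contract[symmetric]
    by (simp add: hodge3_def gprod_raise1 raise3_wedge3 k sum_distrib_left algebra_simps sum.distrib sum_subtractf)
  then show ?thesis by blast
qed

lemma hodge3_orthogonal:
  assumes "volume_element g \<eta>"
  shows "gprod g a (hodge3 g \<eta> (wedge3 g a b c)) = 0" "gprod g b (hodge3 g \<eta> (wedge3 g a b c)) = 0"
proof -
  obtain k where k: "\<And>v. gprod g v (hodge3 g \<eta> (wedge3 g a b c)) = k *
     (rows_det v a b c - rows_det v a c b + rows_det v c a b - rows_det v b a c + rows_det v b c a - rows_det v c b a)"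
    using gprod_hodge3_wedge3[OF assms] by blast
  show "gprod g a (hodge3 g \<eta> (wedge3 g a b c)) = 0" "gprod g b (hodge3 g \<eta> (wedge3 g a b c)) = 0"
    by (simp_all add: k rows_det_repeated)
qed

end

section \<open>Symmetric traceless complex matrices with vanishing square\<close>

lemma member_le_double_sum:
  fixes f :: "4 \<Rightarrow> 4 \<Rightarrow> real"
  assumes "i \<in> A" "j \<in> A" "\<And>i j. 0 \<le> f i j"
  shows "f i j \<le> (\<Sum>i\<in>A. \<Sum>j\<in>A. f i j)"
proof -
  have "f i j \<le> (\<Sum>j\<in>A. f i j)"
    by (rule member_le_sum) (use assms in auto)
  also have "\<dots> \<le> (\<Sum>i\<in>A. \<Sum>j\<in>A. f i j)"
    by (rule member_le_sum) (use assms in \<open>auto intro: sum_nonneg\<close>)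
  finally show ?thesis .
qed

text \<open>Only the spatial values 1, 2, 3 of the index type matter here, so \<open>Q\<close>
  stands for a 3 by 3 matrix.\<close>

locale symmetric_traceless =
  fixes Q :: "4 \<Rightarrow> 4 \<Rightarrow> complex"
  assumes sym: "Q 2 1 = Q 1 2" "Q 3 1 = Q 1 3" "Q 3 2 = Q 2 3"
    and traceless: "Q 1 1 + Q 2 2 + Q 3 3 = 0"
begin

text \<open>Since \<open>Q\<close> is symmetric, its conjugate is its adjoint; thus \<open>M\<close>
  is \<open>Q Q^*\<close>.\<close>

definition M :: "4 \<Rightarrow> 4 \<Rightarrow> complex" where
  "M i j = (\<Sum>k\<in>{1, 2, 3}. Q i k * cnj (Q k j))"

definition N :: "4 \<Rightarrow> 4 \<Rightarrow> complex" where
  "N i j = (\<Sum>k\<in>{1, 2, 3}. Q i k * Q k j)"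

definition t :: real where
  "t = (\<Sum>i\<in>{1, 2, 3}. \<Sum>j\<in>{1, 2, 3}. (cmod (Q i j))\<^sup>2)"

text \<open>Writing \<open>Q'\<close> for the conjugate of \<open>Q\<close>, the left side is
  \<open>tr (M M^T) = tr (Q Q' Q' Q)\<close>. Cyclicity of the trace makes it
  \<open>tr (N N')\<close> with \<open>N = Q Q\<close>, and \<open>N\<close> is symmetric.\<close>

lemma sum_M_square:
  "(\<Sum>i\<in>{1, 2, 3}. \<Sum>j\<in>{1, 2, 3}. M i j * M i j) = (\<Sum>i\<in>{1, 2, 3}. \<Sum>j\<in>{1, 2, 3}. N i j * cnj (N i j))"
  by (simp add: M_def N_def sym algebra_simps)

lemma N_eq_zero:
  assumes "Re (\<Sum>i\<in>{1, 2, 3}. \<Sum>j\<in>{1, 2, 3}. M i j * M i j) = 0"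
    and "i \<in> {1, 2, 3}" "j \<in> {1, 2, 3}"
  shows "N i j = 0"
proof -
  have "Re (\<Sum>i\<in>{1, 2, 3}. \<Sum>j\<in>{1, 2, 3}. N i j * cnj (N i j)) = 0"
    using assms(1) unfolding sum_M_square .
  then have "(\<Sum>i\<in>{1, 2, 3}. \<Sum>j\<in>{1, 2, 3}. (cmod (N i j))\<^sup>2) = 0"
    by (simp only: Re_sum complex_norm_square[symmetric] Re_complex_of_real)
  moreover have "(cmod (N i j))\<^sup>2 \<le> (\<Sum>i\<in>{1, 2, 3}. \<Sum>j\<in>{1, 2, 3}. (cmod (N i j))\<^sup>2)"
    using assms(2,3) by (rule member_le_double_sum) simp
  ultimately show ?thesis by simp
qed

lemma t_pos:
  assumes "i \<in> {1, 2, 3}" "j \<in> {1, 2, 3}" "Q i j \<noteq> 0"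
  shows "t > 0"
proof -
  have "(cmod (Q i j))\<^sup>2 \<le> t"
    unfolding t_def using assms(1,2) by (rule member_le_double_sum) simp
  moreover have "(cmod (Q i j))\<^sup>2 > 0"
    using assms(3) by simp
  ultimately show ?thesis by linarith
qed

lemma t_eq: "complex_of_real t = (\<Sum>i\<in>{1, 2, 3}. \<Sum>j\<in>{1, 2, 3}. Q i j * cnj (Q i j))"
  by (simp only: t_def of_real_sum complex_norm_square)

lemma M_cnj: "cnj (M 1 2) = M 2 1" "cnj (M 3 1) = M 1 3" "cnj (M 2 3) = M 3 2"
  by (simp_all add: M_def sym mult.commute)

context
  assumes square_zero: "\<And>i j. i \<in> {1, 2, 3} \<Longrightarrow> j \<in> {1, 2, 3} \<Longrightarrow> N i j = 0"
begin

text \<open>By Cayley-Hamilton the adjugate of a 3 by 3 matrix is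
  \<open>Q^2 - (tr Q) Q + ((tr Q)^2 - tr (Q^2)) / 2\<close>. Every term vanishes here, and the six
  equations are its entries.\<close>

lemma minors:
  "Q 1 1 * Q 2 2 = Q 1 2 * Q 1 2" "Q 1 1 * Q 3 3 = Q 1 3 * Q 1 3" "Q 2 2 * Q 3 3 = Q 2 3 * Q 2 3"
  "Q 1 3 * Q 2 3 = Q 1 2 * Q 3 3" "Q 1 2 * Q 2 3 = Q 1 3 * Q 2 2" "Q 1 2 * Q 1 3 = Q 1 1 * Q 2 3"
proof -
  have n: "Q 1 1 * Q 1 1 + Q 1 2 * Q 1 2 + Q 1 3 * Q 1 3 = 0"
    "Q 1 2 * Q 1 2 + Q 2 2 * Q 2 2 + Q 2 3 * Q 2 3 = 0"
    "Q 1 3 * Q 1 3 + Q 2 3 * Q 2 3 + Q 3 3 * Q 3 3 = 0"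
    "Q 1 1 * Q 1 2 + Q 1 2 * Q 2 2 + Q 1 3 * Q 2 3 = 0"
    "Q 1 1 * Q 1 3 + Q 1 2 * Q 2 3 + Q 1 3 * Q 3 3 = 0"
    "Q 1 2 * Q 1 3 + Q 2 2 * Q 2 3 + Q 2 3 * Q 3 3 = 0"
    using square_zero[of 1 1] square_zero[of 2 2] square_zero[of 3 3]
      square_zero[of 1 2] square_zero[of 1 3] square_zero[of 2 3]
    by (simp_all add: N_def sym add.assoc)
  have f: "Q 3 3 = - Q 1 1 - Q 2 2"
    using traceless by (simp add: eq_neg_iff_add_eq_0 algebra_simps)
  \<comment> \<open>One diagonal entry of \<open>Q^2\<close> minus the other two, after eliminating
    a diagonal entry of \<open>Q\<close>, is twice a principal minor.\<close>
  have "2 * (Q 1 1 * Q 2 2) = 2 * (Q 1 2 * Q 1 2)" using n(1-3) unfolding f by algebra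
  then show "Q 1 1 * Q 2 2 = Q 1 2 * Q 1 2" by simp
  have "2 * (Q 1 1 * Q 3 3) = 2 * (Q 1 3 * Q 1 3)" using n(1-3) unfolding f by algebra
  then show "Q 1 1 * Q 3 3 = Q 1 3 * Q 1 3" by simp
  have "2 * (Q 2 2 * Q 3 3) = 2 * (Q 2 3 * Q 2 3)" using n(1-3) unfolding f by algebra
  then show "Q 2 2 * Q 3 3 = Q 2 3 * Q 2 3" by simp
  show "Q 1 3 * Q 2 3 = Q 1 2 * Q 3 3" using n(4) unfolding f by algebra
  show "Q 1 2 * Q 2 3 = Q 1 3 * Q 2 2" using n(5) unfolding f by algebra
  show "Q 1 2 * Q 1 3 = Q 1 1 * Q 2 3" using n(6) unfolding f by algebra
qed

lemma rank_one:
  assumes "i \<in> {1, 2, 3}" "j \<in> {1, 2, 3}" "k \<in> {1, 2, 3}" "l \<in> {1, 2, 3}"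
  shows "Q i j * Q k l = Q i l * Q k j"
  using assms minors minors[symmetric] by (auto simp: sym mult.commute)

text \<open>Rank one permits exchanging column indices:
  \<open>Q i m * Q k l = Q i l * Q k m\<close>. The factor \<open>Q i l\<close> then leaves the
  double sum, and what remains is the trace of \<open>M\<close>, namely \<open>t\<close>.\<close>

lemma M_mult_Q:
  assumes "i \<in> {1, 2, 3}" "l \<in> {1, 2, 3}"
  shows "(\<Sum>k\<in>{1, 2, 3}. M i k * Q k l) = of_real t * Q i l"
proof -
  have "(\<Sum>k\<in>{1, 2, 3}. M i k * Q k l) = (\<Sum>k\<in>{1, 2, 3}. \<Sum>m\<in>{1, 2, 3}. cnj (Q m k) * (Q i m * Q k l))"
    unfolding M_def sum_distrib_right by (simp only: mult_ac)
  also have "\<dots> = (\<Sum>k\<in>{1, 2, 3}. \<Sum>m\<in>{1, 2, 3}. cnj (Q m k) * (Q i l * Q k m))"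
    by (intro sum.cong refl arg_cong2[of _ _ _ _ "(*)"] rank_one assms)
  also have "\<dots> = (\<Sum>k\<in>{1, 2, 3}. \<Sum>m\<in>{1, 2, 3}. Q k m * cnj (Q m k)) * Q i l"
    unfolding sum_distrib_right by (simp only: mult_ac)
  also have "(\<Sum>k\<in>{1, 2, 3}. \<Sum>m\<in>{1, 2, 3}. Q k m * cnj (Q m k)) = of_real t"
    unfolding t_eq by (simp add: sym)
  finally show ?thesis .
qed

text \<open>The transpose of \<open>M\<close> is the conjugate of \<open>Q\<close> times
  \<open>Q\<close>, so its product with \<open>Q\<close> contains the factor
  \<open>Q^2 = 0\<close>.\<close>

lemma transpose_M_mult_Q:
  assumes "i \<in> {1, 2, 3}" "l \<in> {1, 2, 3}"
  shows "(\<Sum>k\<in>{1, 2, 3}. M k i * Q k l) = 0"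
proof -
  have "(\<Sum>k\<in>{1, 2, 3}. M k i * Q k l) = (\<Sum>k\<in>{1, 2, 3}. \<Sum>m\<in>{1, 2, 3}. cnj (Q m i) * (Q k m * Q k l))"
    unfolding M_def sum_distrib_right by (simp only: mult_ac)
  also have "\<dots> = (\<Sum>m\<in>{1, 2, 3}. \<Sum>k\<in>{1, 2, 3}. cnj (Q m i) * (Q k m * Q k l))"
    by (rule sum.swap)
  also have "\<dots> = (\<Sum>m\<in>{1, 2, 3}. cnj (Q m i) * N m l)"
    unfolding N_def sum_distrib_left by (simp add: sym)
  also have "\<dots> = 0"
    by (rule sum.neutral) (use square_zero assms in simp)
  finally show ?thesis .
qed

text \<open>The cross product with the axial vector of \<open>M\<close> is \<open>M - M\<^sup>T\<close> up to a factor \<open>\<i>\<close>, and \<open>M Q = t Q\<close>, \<open>M\<^sup>T Q = 0\<close>.\<close>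

lemma cross_column:
  fixes r :: real
  assumes "l \<in> {1, 2, 3}"
  defines "s1 \<equiv> 2 * r * Im (M 2 3)" and "s2 \<equiv> 2 * r * Im (M 3 1)" and "s3 \<equiv> 2 * r * Im (M 1 2)"
  shows "of_real s2 * Q 3 l - of_real s3 * Q 2 l = \<i> * of_real (r * t) * Q 1 l"
    "of_real s3 * Q 1 l - of_real s1 * Q 3 l = \<i> * of_real (r * t) * Q 2 l"
    "of_real s1 * Q 2 l - of_real s2 * Q 1 l = \<i> * of_real (r * t) * Q 3 l"
proof -
  have im: "complex_of_real (2 * r * Im z) = of_real r * (\<i> * (cnj z - z))" for z
    by (simp add: complex_eq_iff)
  have s: "complex_of_real s1 = of_real r * (\<i> * (M 3 2 - M 2 3))"
    "complex_of_real s2 = of_real r * (\<i> * (M 1 3 - M 3 1))"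
    "complex_of_real s3 = of_real r * (\<i> * (M 2 1 - M 1 2))"
    unfolding s1_def s2_def s3_def by (simp_all only: im M_cnj)
  have d: "M i 1 * Q 1 l + (M i 2 * Q 2 l + M i 3 * Q 3 l) - (M 1 i * Q 1 l + (M 2 i * Q 2 l + M 3 i * Q 3 l)) = of_real t * Q i l"
    if "i \<in> {1, 2, 3}" for i
    using M_mult_Q[of i l] transpose_M_mult_Q[of i l] that assms by simp
  show "of_real s2 * Q 3 l - of_real s3 * Q 2 l = \<i> * of_real (r * t) * Q 1 l"
    using d[of 1] unfolding s by simp algebra
  show "of_real s3 * Q 1 l - of_real s1 * Q 3 l = \<i> * of_real (r * t) * Q 2 l"
    using d[of 2] unfolding s by simp algebra
  show "of_real s1 * Q 2 l - of_real s2 * Q 1 l = \<i> * of_real (r * t) * Q 3 l"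
    using d[of 3] unfolding s by simp algebra
qed

end

end

text \<open>From \<open>s \<times> x = w x\<close> with \<open>w\<close> nonzero, \<open>s\<close>
  is orthogonal to \<open>x\<close>. The double cross product
  \<open>s \<times> (s \<times> x)\<close> then equals both \<open>- (s.s) x\<close> and
  \<open>w^2 x\<close>.\<close>

lemma cross_eigenvector_norm:
  fixes s1 s2 s3 w x1 x2 x3 :: complex
  assumes "s2 * x3 - s3 * x2 = w * x1" "s3 * x1 - s1 * x3 = w * x2" "s1 * x2 - s2 * x1 = w * x3"
    and "w \<noteq> 0" and "x1 \<noteq> 0 \<or> x2 \<noteq> 0 \<or> x3 \<noteq> 0"
  shows "s1 * s1 + s2 * s2 + s3 * s3 = - w * w"
proof -
  have "w * (s1 * x1 + s2 * x2 + s3 * x3) = 0"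
    using assms(1-3) by algebra
  then have o: "s1 * x1 + s2 * x2 + s3 * x3 = 0" using \<open>w \<noteq> 0\<close> by simp
  have "(s1 * s1 + s2 * s2 + s3 * s3 + w * w) * x1 = 0"
    "(s1 * s1 + s2 * s2 + s3 * s3 + w * w) * x2 = 0"
    "(s1 * s1 + s2 * s2 + s3 * s3 + w * w) * x3 = 0"
    using assms(1-3) o by algebra+
  then have "s1 * s1 + s2 * s2 + s3 * s3 + w * w = 0"
    using assms(5) by auto
  then show ?thesis by (simp add: eq_neg_iff_add_eq_0)
qed

text \<open>Expansion of \<open>x\<close> in the basis \<open>p\<close>, \<open>n \<times> p\<close>, \<open>n\<close>: the last coefficient vanishes.\<close>

lemma cross_eigenvector_expand:
  fixes n1 n2 n3 p1 p2 p3 c x1 x2 x3 :: complex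
  assumes "n2 * x3 - n3 * x2 = c * x1" "n3 * x1 - n1 * x3 = c * x2" "n1 * x2 - n2 * x1 = c * x3"
    and "c * c = -1" and "p1 * p1 + p2 * p2 + p3 * p3 = 1" and "n1 * p1 + n2 * p2 + n3 * p3 = 0"
  defines "d \<equiv> p1 * x1 + p2 * x2 + p3 * x3"
  shows "x1 = d * (p1 - c * (n2 * p3 - n3 * p2))" "x2 = d * (p2 - c * (n3 * p1 - n1 * p3))"
    "x3 = d * (p3 - c * (n1 * p2 - n2 * p1))"
  using assms(1-6) unfolding d_def by algebra+

section \<open>The self-dual Weyl tensor in a frame\<close>

text \<open>The Hodge dual of a 2-form in a frame whose volume element is \<open>r\<close> times the
  permutation symbol.\<close>

definition frame_dual :: "real \<Rightarrow> real tensor2 \<Rightarrow> real tensor2" where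
  "frame_dual r f i j = (1/2) * (\<Sum>m\<in>UNIV. \<Sum>n\<in>UNIV.
     causal_sign m * (causal_sign n * (r * levi_civita i j m n * f m n)))"

text \<open>For \<open>r\<close> equal to 1 or -1 this is the eigenvalue equation
  \<open>*G = \<i> G\<close>, solved for the magnetic components in terms of the electric ones
  \<open>G 0 a\<close>.\<close>

definition self_dual_form :: "real \<Rightarrow> complex tensor2 \<Rightarrow> bool" where
  "self_dual_form r G \<longleftrightarrow> (\<forall>i j. G j i = - G i j) \<and>
     G 2 3 = \<i> * r * G 0 1 \<and> G 3 1 = \<i> * r * G 0 2 \<and> G 1 2 = \<i> * r * G 0 3"

lemma frame_dual_values:
  assumes "\<And>i j. f j i = - f i j"
  shows "frame_dual r f j i = - frame_dual r f i j"
    "frame_dual r f 0 1 = r * f 2 3" "frame_dual r f 0 2 = r * f 3 1" "frame_dual r f 0 3 = r * f 1 2"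
    "frame_dual r f 2 3 = - r * f 0 1" "frame_dual r f 3 1 = - r * f 0 2" "frame_dual r f 1 2 = - r * f 0 3"
proof -
  show "frame_dual r f j i = - frame_dual r f i j"
    unfolding frame_dual_def levi_civita_swap(1)[of j i] by (simp add: sum_negf)
qed (simp_all add: frame_dual_def sum_index4 levi_civita_values assms[of 1 0] assms[of 2 0] assms[of 3 0]
      assms[of 3 2] assms[of 1 3] assms[of 2 1])

text \<open>On 2-forms in Lorentzian signature the dual squares to -1, so \<open>f - \<i> *f\<close>
  is an eigenvector with eigenvalue \<open>\<i>\<close>.\<close>

lemma self_dual_form_self_dual_part:
  assumes "\<And>i j. f j i = - f i j" and "r = 1 \<or> r = -1"
  shows "self_dual_form r (\<lambda>i j. c * (of_real (f i j) - \<i> * of_real (frame_dual r f i j)))"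
  unfolding self_dual_form_def
proof (intro conjI allI)
  note dual = frame_dual_values[OF assms(1)]
  fix i j
  have "f j i = - f i j" "frame_dual r f j i = - frame_dual r f i j"
    by (rule assms(1) dual(1))+
  then show "c * (of_real (f j i) - \<i> * of_real (frame_dual r f j i)) =
      - (c * (of_real (f i j) - \<i> * of_real (frame_dual r f i j)))"
    by (simp only:) (simp add: algebra_simps)
qed (use assms(2) in \<open>auto simp: frame_dual_values(2-7)[OF assms(1)] algebra_simps\<close>)

lemma self_dual_form_scale:
  assumes "self_dual_form r G"
  shows "self_dual_form r (\<lambda>i j. c * G i j)"
proof -
  have "G j i = - G i j" for i j
    using assms unfolding self_dual_form_def by blast
  then have "c * G j i = - (c * G i j)" for i j
    by (metis mult_minus_right)
  moreover have "G 2 3 = \<i> * r * G 0 1" "G 3 1 = \<i> * r * G 0 2" "G 1 2 = \<i> * r * G 0 3"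
    using assms unfolding self_dual_form_def by blast+
  then have "c * G 2 3 = \<i> * r * (c * G 0 1)" "c * G 3 1 = \<i> * r * (c * G 0 2)" "c * G 1 2 = \<i> * r * (c * G 0 3)"
    by (simp_all only: mult.left_commute)
  ultimately show ?thesis
    unfolding self_dual_form_def by blast
qed

lemma self_dual_form_diag:
  assumes "self_dual_form r G"
  shows "G i i = 0"
proof -
  have "G i i = - G i i"
    using assms unfolding self_dual_form_def by blast
  then show ?thesis by (simp only: complex_eq_iff) simp
qed

lemma self_dual_form_components:
  assumes "self_dual_form r G"
  shows "G 1 0 = - G 0 1" "G 2 0 = - G 0 2" "G 3 0 = - G 0 3"
    "G 2 3 = \<i> * r * G 0 1" "G 3 1 = \<i> * r * G 0 2" "G 1 2 = \<i> * r * G 0 3"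
    "G 3 2 = - (\<i> * r * G 0 1)" "G 1 3 = - (\<i> * r * G 0 2)" "G 2 1 = - (\<i> * r * G 0 3)"
proof -
  have a: "G j i = - G i j" for i j
    using assms unfolding self_dual_form_def by blast
  show b: "G 2 3 = \<i> * r * G 0 1" "G 3 1 = \<i> * r * G 0 2" "G 1 2 = \<i> * r * G 0 3"
    using assms unfolding self_dual_form_def by blast+
  show "G 1 0 = - G 0 1" "G 2 0 = - G 0 2" "G 3 0 = - G 0 3" by (rule a)+
  show "G 3 2 = - (\<i> * r * G 0 1)" "G 1 3 = - (\<i> * r * G 0 2)" "G 2 1 = - (\<i> * r * G 0 3)"
    unfolding b[symmetric] by (rule a)+
qed

lemma self_dual_form_ext:
  assumes "self_dual_form r G" "self_dual_form r H"
    and "\<And>a. a \<in> {1, 2, 3} \<Longrightarrow> G 0 a = H 0 a"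
  shows "G i j = H i j"
  using index4_cases[of i] index4_cases[of j]
    self_dual_form_components[OF assms(1)] self_dual_form_diag[OF assms(1)]
    self_dual_form_components[OF assms(2)] self_dual_form_diag[OF assms(2)]
    assms(3)[of 1] assms(3)[of 2] assms(3)[of 3]
  by (elim disjE) simp_all

section \<open>Double self-duality and reduction to a 3 by 3 matrix\<close>

locale weyl_frame = orthonormal_frame +
  fixes \<eta> W :: "real tensor4" and r :: real
  assumes weyl: "weyl_tensor g W" and r: "r = 1 \<or> r = -1"
    and volume: "frame_comp4 e \<eta> i j k l = r * levi_civita i j k l"
begin

definition w :: "real tensor4" where "w = frame_comp4 e W"

definition sd :: "complex tensor4" where "sd = frame_comp4 e (self_dual_weyl g \<eta> W)"

text \<open>The electric block of the self-dual tensor: its real part is half the electric part of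
  \<open>W\<close>, its imaginary part up to sign half the magnetic part.\<close>

definition Q :: "complex tensor2" where "Q a b = sd 0 a 0 b"

lemma frame_comp2_hodge2_eq: "frame_comp2 e (hodge2 g \<eta> F) = frame_dual r (frame_comp2 e F)"
  by (simp add: fun_eq_iff frame_comp2_hodge2 frame_dual_def volume)

lemma frame_comp4_hodge_double_eq:
  "frame_comp4 e (hodge_double g \<eta> W) i j k l = frame_dual r (\<lambda>i j. w i j k l) i j"
  by (simp add: frame_comp4_hodge_double frame_dual_def volume w_def)

lemmas w_weyl = frame_comp4_weyl[OF weyl, folded w_def]

lemma sd_eq: "sd i j k l = (1/2) * (of_real (w i j k l) - \<i> * of_real (frame_dual r (\<lambda>i j. w i j k l) i j))"
proof -
  have "sd i j k l = (1/2) * (of_real (w i j k l) - \<i> * of_real (frame_comp4 e (hodge_double g \<eta> W) i j k l))"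
    by (simp only: sd_def w_def self_dual_weyl_def[abs_def] frame_comp4_def frame_comp2_def frame_comp_linear)
  then show ?thesis by (simp only: frame_comp4_hodge_double_eq)
qed

lemma sd_left: "self_dual_form r (\<lambda>i j. sd i j k l)"
  unfolding sd_eq by (rule self_dual_form_self_dual_part[OF w_weyl(1) r])

lemma sd_antisym_right: "sd i j l k = - sd i j k l"
proof -
  have "(\<lambda>i j. w i j l k) = (\<lambda>i j. - w i j k l)"
    by (intro ext w_weyl(2))
  moreover have "frame_dual r (\<lambda>i j. - w i j k l) i j = - frame_dual r (\<lambda>i j. w i j k l) i j"
    by (simp add: frame_dual_def sum_negf)
  ultimately show ?thesis
    unfolding sd_eq by (simp add: w_weyl(2)[of i j l k] field_simps)
qed

text \<open>All equations are linear consequences of the vanishing traces and one cyclic identity.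
  The first nine express that dualising the first or the second index pair gives the same result;
  the last two say that the magnetic and electric parts are traceless.\<close>

lemma w_electric_magnetic:
  "w 2 3 2 3 = - w 0 1 0 1" "w 2 3 3 1 = - w 0 1 0 2" "w 2 3 1 2 = - w 0 1 0 3"
  "w 3 1 3 1 = - w 0 2 0 2" "w 3 1 1 2 = - w 0 2 0 3" "w 1 2 1 2 = - w 0 3 0 3"
  "w 0 2 2 3 = w 0 1 3 1" "w 0 3 2 3 = w 0 1 1 2" "w 0 3 3 1 = w 0 2 1 2"
  "w 0 1 2 3 + w 0 2 3 1 + w 0 3 1 2 = 0"
  "w 0 1 0 1 + w 0 2 0 2 + w 0 3 0 3 = 0"
proof -
  have diag: "w i i k l = 0" "w i j k k = 0" for i j k l
    using w_weyl(1)[of i i k l] w_weyl(2)[of i j k k] by simp_all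
  note left = w_weyl(1)[of 1 0] w_weyl(1)[of 2 0] w_weyl(1)[of 3 0] w_weyl(1)[of 3 2] w_weyl(1)[of 1 3] w_weyl(1)[of 2 1]
  note right = w_weyl(2)[where k = 0 and l = 1] w_weyl(2)[where k = 0 and l = 2] w_weyl(2)[where k = 0 and l = 3]
    w_weyl(2)[where k = 2 and l = 3] w_weyl(2)[where k = 3 and l = 1] w_weyl(2)[where k = 1 and l = 2]
  note pair = w_weyl(3)[where i = 0 and j = 1 and k = 0 and l = 2] w_weyl(3)[where i = 0 and j = 1 and k = 0 and l = 3]
    w_weyl(3)[where i = 0 and j = 2 and k = 0 and l = 3]
    w_weyl(3)[where i = 2 and j = 3 and k = 3 and l = 1] w_weyl(3)[where i = 2 and j = 3 and k = 1 and l = 2]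
    w_weyl(3)[where i = 3 and j = 1 and k = 1 and l = 2]
    w_weyl(3)[where i = 0 and k = 2 and l = 3] w_weyl(3)[where i = 0 and k = 3 and l = 1] w_weyl(3)[where i = 0 and k = 1 and l = 2]
  note trace = w_weyl(5)[of 0 0] w_weyl(5)[of 0 1] w_weyl(5)[of 0 2] w_weyl(5)[of 0 3] w_weyl(5)[of 1 1] w_weyl(5)[of 2 2]
    w_weyl(5)[of 3 3] w_weyl(5)[of 1 2] w_weyl(5)[of 1 3] w_weyl(5)[of 2 3]
  have eqs: "w 0 1 2 3 + w 0 2 3 1 + w 0 3 1 2 = 0"
    "w 0 1 0 1 + (w 0 2 0 2 + w 0 3 0 3) = 0"
    "w 0 2 1 2 - w 0 3 3 1 = 0" "w 0 3 2 3 - w 0 1 1 2 = 0" "w 0 1 3 1 - w 0 2 2 3 = 0"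
    "w 1 2 1 2 + w 3 1 3 1 - w 0 1 0 1 = 0" "w 1 2 1 2 + w 2 3 2 3 - w 0 2 0 2 = 0"
    "w 3 1 3 1 + w 2 3 2 3 - w 0 3 0 3 = 0"
    "- w 0 1 0 2 - w 2 3 3 1 = 0" "- w 0 1 0 3 - w 2 3 1 2 = 0" "- w 0 2 0 3 - w 3 1 1 2 = 0"
    using trace w_weyl(4)[of 0 1 2 3] by (simp_all add: sum_index4 diag left right pair)
  show "w 2 3 2 3 = - w 0 1 0 1" "w 2 3 3 1 = - w 0 1 0 2" "w 2 3 1 2 = - w 0 1 0 3"
  "w 3 1 3 1 = - w 0 2 0 2" "w 3 1 1 2 = - w 0 2 0 3" "w 1 2 1 2 = - w 0 3 0 3"
  "w 0 2 2 3 = w 0 1 3 1" "w 0 3 2 3 = w 0 1 1 2" "w 0 3 3 1 = w 0 2 1 2"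
  "w 0 1 2 3 + w 0 2 3 1 + w 0 3 1 2 = 0"
  "w 0 1 0 1 + w 0 2 0 2 + w 0 3 0 3 = 0"
    using eqs by linarith+
qed

text \<open>Self-duality in the first pair is built into the definition; in the second pair it rests
  on the Weyl identities. They are checked for the rows \<open>0 a\<close>, and self-duality in the
  first pair carries the result to all rows.\<close>

lemma sd_right: "self_dual_form r (sd i j)"
proof -
  note dual = frame_dual_values(2-7)[of "\<lambda>i j. w i j k l" for k l, OF w_weyl(1)]
  have pair: "w 2 3 0 a = w 0 a 2 3" "w 3 1 0 a = w 0 a 3 1" "w 1 2 0 a = w 0 a 1 2"
    "w 3 1 2 3 = w 2 3 3 1" "w 1 2 2 3 = w 2 3 1 2" "w 1 2 3 1 = w 3 1 1 2"
    "w 0 2 0 1 = w 0 1 0 2" "w 0 3 0 1 = w 0 1 0 3" "w 0 3 0 2 = w 0 2 0 3" for a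
    by (rule w_weyl(3))+
  have "sd 0 a 2 3 = \<i> * r * sd 0 a 0 1 \<and> sd 0 a 3 1 = \<i> * r * sd 0 a 0 2 \<and> sd 0 a 1 2 = \<i> * r * sd 0 a 0 3"
    if "a \<in> {1, 2, 3}" for a
    using that r by (auto simp: sd_eq dual pair w_electric_magnetic(1-9) complex_eq_iff)
  then have *: "sd 0 a 2 3 = \<i> * r * sd 0 a 0 1" "sd 0 a 3 1 = \<i> * r * sd 0 a 0 2" "sd 0 a 1 2 = \<i> * r * sd 0 a 0 3"
    if "a \<in> {1, 2, 3}" for a
    using that by blast+
  have "sd i j 2 3 = \<i> * r * sd i j 0 1"
    by (rule self_dual_form_ext[OF sd_left self_dual_form_scale[OF sd_left]]) (rule *)
  moreover have "sd i j 3 1 = \<i> * r * sd i j 0 2"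
    by (rule self_dual_form_ext[OF sd_left self_dual_form_scale[OF sd_left]]) (rule *)
  moreover have "sd i j 1 2 = \<i> * r * sd i j 0 3"
    by (rule self_dual_form_ext[OF sd_left self_dual_form_scale[OF sd_left]]) (rule *)
  ultimately show ?thesis
    unfolding self_dual_form_def using sd_antisym_right by blast
qed

lemma symmetric_traceless_Q: "symmetric_traceless Q"
proof
  note dual = frame_dual_values(2-7)[of "\<lambda>i j. w i j k l" for k l, OF w_weyl(1)]
  have pair: "w 2 3 0 a = w 0 a 2 3" "w 3 1 0 a = w 0 a 3 1" "w 1 2 0 a = w 0 a 1 2"
    "w 0 2 0 1 = w 0 1 0 2" "w 0 3 0 1 = w 0 1 0 3" "w 0 3 0 2 = w 0 2 0 3" for a
    by (rule w_weyl(3))+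
  show "Q 2 1 = Q 1 2" "Q 3 1 = Q 1 3" "Q 3 2 = Q 2 3"
    by (simp_all add: Q_def sd_eq dual pair w_electric_magnetic(7-9) complex_eq_iff)
  have "r * w 0 1 2 3 + r * w 0 2 3 1 + r * w 0 3 1 2 = 0"
    using w_electric_magnetic(10) by (simp flip: distrib_left)
  then show "Q 1 1 + Q 2 2 + Q 3 3 = 0"
    using w_electric_magnetic(11) by (simp add: Q_def sd_eq dual pair complex_eq_iff)
qed

sublocale symmetric_traceless Q by (rule symmetric_traceless_Q)

lemma Q_time: "Q 0 a = 0" "Q a 0 = 0"
  unfolding Q_def by (rule self_dual_form_diag[OF sd_left] self_dual_form_diag[OF sd_right])+

lemma sd_components:
  "sd i j 1 0 = - sd i j 0 1" "sd i j 2 0 = - sd i j 0 2" "sd i j 3 0 = - sd i j 0 3"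
  "sd i j 2 3 = \<i> * r * sd i j 0 1" "sd i j 3 1 = \<i> * r * sd i j 0 2" "sd i j 1 2 = \<i> * r * sd i j 0 3"
  "sd i j 3 2 = - (\<i> * r * sd i j 0 1)" "sd i j 1 3 = - (\<i> * r * sd i j 0 2)" "sd i j 2 1 = - (\<i> * r * sd i j 0 3)"
  "sd 1 0 i j = - sd 0 1 i j" "sd 2 0 i j = - sd 0 2 i j" "sd 3 0 i j = - sd 0 3 i j"
  "sd 2 3 i j = \<i> * r * sd 0 1 i j" "sd 3 1 i j = \<i> * r * sd 0 2 i j" "sd 1 2 i j = \<i> * r * sd 0 3 i j"
  "sd 3 2 i j = - (\<i> * r * sd 0 1 i j)" "sd 1 3 i j = - (\<i> * r * sd 0 2 i j)" "sd 2 1 i j = - (\<i> * r * sd 0 3 i j)"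
  "sd k k i j = 0" "sd i j k k = 0" "sd 0 a 0 b = Q a b"
  "Q 0 a = 0" "Q a 0 = 0"
  by (fact self_dual_form_components[OF sd_right] self_dual_form_components[OF sd_left]
      self_dual_form_diag[OF sd_left] self_dual_form_diag[OF sd_right] Q_def[symmetric] Q_time)+

text \<open>Self-duality in both pairs leaves the block \<open>0 a 0 b\<close> as the only data, so
  two such tensors are compared there.\<close>

lemma sd_ext:
  assumes "\<And>i j. self_dual_form r (B i j)" "\<And>k l. self_dual_form r (\<lambda>i j. B i j k l)"
    and "\<And>a b. a \<in> {1, 2, 3} \<Longrightarrow> b \<in> {1, 2, 3} \<Longrightarrow> Q a b = B 0 a 0 b"
  shows "sd i j k l = B i j k l"
proof (rule self_dual_form_ext[OF sd_left assms(2)])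
  fix a :: 4 assume a: "a \<in> {1, 2, 3}"
  show "sd 0 a k l = B 0 a k l"
    by (rule self_dual_form_ext[OF sd_right assms(1)]) (use assms(3) a in \<open>simp add: Q_def\<close>)
qed

section \<open>Bel-Robinson components with time indices\<close>

definition br :: "real tensor4" where "br = frame_comp4 e (bel_robinson g \<eta> W)"

text \<open>The real part of \<open>(w - \<i> v) (w' + \<i> v') / 4\<close> is
  \<open>(w w' + v v') / 4\<close>, the combination in the real definition.\<close>

lemma br_eq: "br i j k l = Re (\<Sum>m\<in>UNIV. \<Sum>n\<in>UNIV.
    of_real (causal_sign m * causal_sign n) * (sd i m k n * cnj (sd j m l n)))"
proof -
  let ?v = "\<lambda>i j k l. frame_dual r (\<lambda>i j. w i j k l) i j"
  have "br i j k l = (1/4) * (frame_comp4 e (bel_contr g W W) i j k l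
      + frame_comp4 e (bel_contr g (hodge_double g \<eta> W) (hodge_double g \<eta> W)) i j k l)"
    by (simp only: br_def bel_robinson_def[abs_def] frame_comp4_def frame_comp2_def frame_comp_linear)
  also have "\<dots> = (1/4) * ((\<Sum>m\<in>UNIV. \<Sum>n\<in>UNIV. causal_sign m * (causal_sign n * (w j m l n * w i m k n)))
      + (\<Sum>m\<in>UNIV. \<Sum>n\<in>UNIV. causal_sign m * (causal_sign n * (?v j m l n * ?v i m k n))))"
    unfolding frame_comp4_bel_contr frame_comp4_hodge_double_eq w_def ..
  also have "\<dots> = (\<Sum>m\<in>UNIV. \<Sum>n\<in>UNIV. (1/4) * (causal_sign m * (causal_sign n * (w j m l n * w i m k n)))
      + (1/4) * (causal_sign m * (causal_sign n * (?v j m l n * ?v i m k n))))"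
    by (simp only: sum.distrib sum_distrib_left distrib_left)
  also have "\<dots> = Re (\<Sum>m\<in>UNIV. \<Sum>n\<in>UNIV.
    of_real (causal_sign m * causal_sign n) * (sd i m k n * cnj (sd j m l n)))"
    unfolding Re_sum by (intro sum.cong refl) (simp add: sd_eq algebra_simps)
  finally show ?thesis .
qed

lemma br_time: "br 0 0 0 0 = t"
proof -
  have "br 0 0 0 0 = Re (of_real t)"
    unfolding t_eq by (simp add: br_eq sum_index4 sd_components algebra_simps)
  then show ?thesis by simp
qed

text \<open>The momentum is the axial vector of the imaginary part of the hermitian matrix
  \<open>M\<close>; its sign follows the orientation \<open>r\<close>. All four positions of the
  spatial index are recorded, as they occur in the square.\<close>

lemma br_momentum:
  "br 1 0 0 0 = 2 * r * Im (M 2 3)" "br 2 0 0 0 = 2 * r * Im (M 3 1)" "br 3 0 0 0 = 2 * r * Im (M 1 2)"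
  "br 0 1 0 0 = br 1 0 0 0" "br 0 2 0 0 = br 2 0 0 0" "br 0 3 0 0 = br 3 0 0 0"
  "br 0 0 1 0 = br 1 0 0 0" "br 0 0 2 0 = br 2 0 0 0" "br 0 0 3 0 = br 3 0 0 0"
  "br 0 0 0 1 = br 1 0 0 0" "br 0 0 0 2 = br 2 0 0 0" "br 0 0 0 3 = br 3 0 0 0"
  using r by (auto simp: br_eq sum_index4 sd_components M_def sym algebra_simps)

lemma br_stress:
  assumes "a \<in> {1, 2, 3}" "b \<in> {1, 2, 3}"
  shows "br 0 0 a b = (if a = b then t else 0) - 2 * Re (M a b)"
    "br a b 0 0 = (if a = b then t else 0) - 2 * Re (M a b)"
proof -
  have t: "t = Re (\<Sum>i\<in>{1, 2, 3}. \<Sum>j\<in>{1, 2, 3}. Q i j * cnj (Q i j))"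
    unfolding t_eq[symmetric] by simp
  show "br 0 0 a b = (if a = b then t else 0) - 2 * Re (M a b)"
    "br a b 0 0 = (if a = b then t else 0) - 2 * Re (M a b)"
    using r assms by (auto simp: br_eq sum_index4 sd_components M_def sym t algebra_simps)
qed

text \<open>Energy, momentum and stress contribute \<open>t^2 - 2 |s|^2 + |S|^2\<close>. As
  \<open>tr M = t\<close>, the stress term is \<open>- t^2\<close> plus four times the sum of the
  squared \<open>Re (M i j)\<close>; the momentum term subtracts four times that of
  \<open>Im (M i j)\<close>.\<close>

lemma br_square: "frame_comp4 e (tensor4_square g (bel_robinson g \<eta> W)) 0 0 0 0 =
  4 * Re (\<Sum>i\<in>{1, 2, 3}. \<Sum>j\<in>{1, 2, 3}. M i j * M i j)"
proof -
  have t: "t = Re (M 1 1) + Re (M 2 2) + Re (M 3 3)"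
  proof -
    have "t = Re (of_real t)" by simp
    also have "\<dots> = Re (M 1 1) + Re (M 2 2) + Re (M 3 3)"
      unfolding t_eq by (simp add: M_def sym algebra_simps)
    finally show ?thesis .
  qed
  have diag: "Im (M 1 1) = 0" "Im (M 2 2) = 0" "Im (M 3 3) = 0"
    by (simp_all add: M_def sym)
  have flip: "M 2 1 = cnj (M 1 2)" "M 1 3 = cnj (M 3 1)" "M 3 2 = cnj (M 2 3)"
    by (rule M_cnj[symmetric])+
  have "frame_comp4 e (tensor4_square g (bel_robinson g \<eta> W)) 0 0 0 0 = (\<Sum>m\<in>UNIV. \<Sum>n\<in>UNIV.
      causal_sign m * (causal_sign n * (br 0 0 m n * br m n 0 0)))"
    unfolding frame_comp4_tensor4_square br_def ..
  also have "\<dots> = 4 * Re (\<Sum>i\<in>{1, 2, 3}. \<Sum>j\<in>{1, 2, 3}. M i j * M i j)"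
    using r by (auto simp: sum_index4 br_time br_momentum br_stress flip diag t algebra_simps)
  finally show ?thesis .
qed

end

section \<open>Reconstruction of the self-dual Weyl tensor\<close>

context weyl_frame
begin

lemma Q_nonzero:
  assumes "bel_robinson g \<eta> W \<noteq> (\<lambda>_ _ _ _. 0)"
  obtains a b where "a \<in> {1, 2, 3}" "b \<in> {1, 2, 3}" "Q a b \<noteq> 0"
proof -
  have False if "\<And>a b. a \<in> {1, 2, 3} \<Longrightarrow> b \<in> {1, 2, 3} \<Longrightarrow> Q a b = 0"
  proof -
    have "sd i j k l = (\<lambda>i j k l. 0) i j k l" for i j k l
      by (rule sd_ext) (use that in \<open>simp_all add: self_dual_form_def\<close>)
    then have "br i j k l = 0" for i j k l
      by (simp add: br_eq)
    then have "bel_robinson g \<eta> W = (\<lambda>_ _ _ _. 0)"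
      by (intro frame_comp4_ext) (simp add: br_def frame_comp4_def frame_comp2_def frame_comp_zero)
    then show False using assms by simp
  qed
  then show ?thesis using that by blast
qed

text \<open>Each column of \<open>Q\<close> is an eigenvector of the cross product with the
  momentum, for the eigenvalue \<open>\<i> r t\<close>. A nonzero column, which exists since
  \<open>T\<close> is nonzero, forces the momentum to have length \<open>t\<close>.\<close>

lemma null_structure:
  assumes nonzero: "bel_robinson g \<eta> W \<noteq> (\<lambda>_ _ _ _. 0)"
    and square: "tensor4_square g (bel_robinson g \<eta> W) = (\<lambda>_ _ _ _. 0)"
  shows "t > 0"
    and "(br 1 0 0 0)\<^sup>2 + (br 2 0 0 0)\<^sup>2 + (br 3 0 0 0)\<^sup>2 = t\<^sup>2"
    and "b \<in> {1, 2, 3} \<Longrightarrow> of_real (br 2 0 0 0) * Q 3 b - of_real (br 3 0 0 0) * Q 2 b = \<i> * of_real (r * t) * Q 1 b"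
    and "b \<in> {1, 2, 3} \<Longrightarrow> of_real (br 3 0 0 0) * Q 1 b - of_real (br 1 0 0 0) * Q 3 b = \<i> * of_real (r * t) * Q 2 b"
    and "b \<in> {1, 2, 3} \<Longrightarrow> of_real (br 1 0 0 0) * Q 2 b - of_real (br 2 0 0 0) * Q 1 b = \<i> * of_real (r * t) * Q 3 b"
proof -
  obtain a c where ac: "a \<in> {1, 2, 3}" "c \<in> {1, 2, 3}" "Q a c \<noteq> 0"
    using Q_nonzero[OF nonzero] by blast
  show pos: "t > 0" by (rule t_pos[OF ac])
  \<comment> \<open>The hypothesis on the square is evaluated on the time axis, where
    \<open>br_square\<close> turns it into \<open>Q^2 = 0\<close>.\<close>
  have "frame_comp4 e (tensor4_square g (bel_robinson g \<eta> W)) 0 0 0 0 = 0"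
    unfolding square by (simp add: frame_comp4_def frame_comp2_def frame_comp_zero)
  then have "Re (\<Sum>i\<in>{1, 2, 3}. \<Sum>j\<in>{1, 2, 3}. M i j * M i j) = 0"
    unfolding br_square by (simp only: mult_eq_0_iff) simp
  then have N: "N i j = 0" if "i \<in> {1, 2, 3}" "j \<in> {1, 2, 3}" for i j
    using that by (rule N_eq_zero)
  show cross: "of_real (br 2 0 0 0) * Q 3 b - of_real (br 3 0 0 0) * Q 2 b = \<i> * of_real (r * t) * Q 1 b"
    "of_real (br 3 0 0 0) * Q 1 b - of_real (br 1 0 0 0) * Q 3 b = \<i> * of_real (r * t) * Q 2 b"
    "of_real (br 1 0 0 0) * Q 2 b - of_real (br 2 0 0 0) * Q 1 b = \<i> * of_real (r * t) * Q 3 b"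
    if "b \<in> {1, 2, 3}" for b
    unfolding br_momentum(1-3) by (rule cross_column[OF N that]; assumption)+
  have "of_real (br 1 0 0 0) * of_real (br 1 0 0 0) + of_real (br 2 0 0 0) * of_real (br 2 0 0 0)
      + of_real (br 3 0 0 0) * of_real (br 3 0 0 0) = - (\<i> * of_real (r * t)) * (\<i> * of_real (r * t))"
    by (rule cross_eigenvector_norm[OF cross[OF ac(2)]]) (use r pos ac in auto)
  also have "\<dots> = of_real (t * t)"
    using r by (auto simp: complex_eq_iff)
  finally have "complex_of_real (br 1 0 0 0 * br 1 0 0 0 + br 2 0 0 0 * br 2 0 0 0 + br 3 0 0 0 * br 3 0 0 0) = of_real (t * t)"
    by (simp only: of_real_add of_real_mult)
  then show "(br 1 0 0 0)\<^sup>2 + (br 2 0 0 0)\<^sup>2 + (br 3 0 0 0)\<^sup>2 = t\<^sup>2"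
    by (simp only: of_real_eq_iff power2_eq_square)
qed

text \<open>The eigenvector equation and the symmetry of \<open>Q\<close> give
  \<open>Q = c m m^T\<close>, with \<open>m\<close> built from the momentum direction and
  \<open>p\<close>. The form \<open>L0\<close> has electric part proportional to \<open>m\<close>,
  so only the modulus of \<open>c\<close> has to be matched.\<close>

lemma self_dual_weyl_null:
  fixes l p :: "real^4"
  defines "L \<equiv> wedge2 g l p"
  defines "L0 \<equiv> (\<lambda>\<alpha> \<beta>. (complex_of_real (L \<alpha> \<beta>) - \<i> * of_real (hodge2 g \<eta> L \<alpha> \<beta>)) / of_real (sqrt 2))"
  assumes nonzero: "bel_robinson g \<eta> W \<noteq> (\<lambda>_ _ _ _. 0)"
    and square: "tensor4_square g (bel_robinson g \<eta> W) = (\<lambda>_ _ _ _. 0)"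
    and l: "\<And>i. gprod g (e i) l = - (sqrt (sqrt t) * (br i 0 0 0 / t))"
    and p: "gprod g (e 0) p = 0" "gprod g p p = 1" "gprod g l p = 0"
  shows "\<exists>\<theta>::real. self_dual_weyl g \<eta> W = (\<lambda>\<alpha> \<beta> \<mu> \<nu>. exp (\<i> * of_real \<theta>) * (L0 \<alpha> \<beta> * L0 \<mu> \<nu>))"
proof -
  note null = null_structure[OF nonzero square]
  \<comment> \<open>\<open>k\<close> is the fourth root of the energy and scales \<open>l\<close>;
    \<open>n\<close> is the momentum per energy and \<open>N\<close> the cross product of
    \<open>n\<close> with the spatial part \<open>P\<close> of \<open>p\<close>. The vector
    \<open>m\<close> spans the eigenline of \<open>cross_eigenvector_expand\<close> for the
    eigenvalue \<open>\<i> r\<close>.\<close>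
  define k where "k = sqrt (sqrt t)"
  define n where "n a = br a 0 0 0 / t" for a
  define P where "P a = gprod g (e a) p" for a
  define N where "N a = (if a = 1 then n 2 * P 3 - n 3 * P 2 else if a = 2 then n 3 * P 1 - n 1 * P 3 else n 1 * P 2 - n 2 * P 1)" for a :: 4
  define m where "m a = complex_of_real (P a) - \<i> * of_real r * of_real (N a)" for a
  have t: "t > 0" by (rule null(1))
  have k: "k > 0" "(k * k) * (k * k) = t"
    using t by (simp_all add: k_def)
  have nn: "(n 1)\<^sup>2 + (n 2)\<^sup>2 + (n 3)\<^sup>2 = 1"
    using null(2) t by (simp add: n_def power_divide flip: add_divide_distrib)
  have PP: "(P 1)\<^sup>2 + (P 2)\<^sup>2 + (P 3)\<^sup>2 = 1"
    using p(1,2) unfolding gprod_frame[of p p] by (simp add: sum_index4 P_def power2_eq_square)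
  have l': "gprod g (e a) l = - (k * n a)" for a
    unfolding l k_def n_def ..
  have "k * (n 1 * P 1 + n 2 * P 2 + n 3 * P 3) = 0"
    using p(1,3) unfolding gprod_frame[of l p] by (simp add: sum_index4 l' P_def algebra_simps)
  then have nP: "n 1 * P 1 + n 2 * P 2 + n 3 * P 3 = 0"
    using k(1) by simp
  have NN: "(N 1)\<^sup>2 + (N 2)\<^sup>2 + (N 3)\<^sup>2 = 1"
  proof -
    \<comment> \<open>Lagrange's identity for the cross product.\<close>
    have "(N 1)\<^sup>2 + (N 2)\<^sup>2 + (N 3)\<^sup>2 =
        ((n 1)\<^sup>2 + (n 2)\<^sup>2 + (n 3)\<^sup>2) * ((P 1)\<^sup>2 + (P 2)\<^sup>2 + (P 3)\<^sup>2) - (n 1 * P 1 + n 2 * P 2 + n 3 * P 3)\<^sup>2"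
      by (simp add: N_def power2_eq_square algebra_simps)
    then show ?thesis by (simp add: nn PP nP)
  qed
  have mm: "(cmod (m 1))\<^sup>2 + (cmod (m 2))\<^sup>2 + (cmod (m 3))\<^sup>2 = 2"
  proof -
    have "(cmod (m a))\<^sup>2 = (P a)\<^sup>2 + (N a)\<^sup>2" for a
      using r by (auto simp: m_def cmod_power2)
    then show ?thesis using PP NN by simp
  qed
  define d where "d b = P 1 * Q 1 b + P 2 * Q 2 b + P 3 * Q 3 b" for b
  have col: "Q a b = d b * m a" if "a \<in> {1, 2, 3}" "b \<in> {1, 2, 3}" for a b
  proof -
    have "complex_of_real (n i) * z = of_real (br i 0 0 0) * z / of_real t" for i z
      by (simp add: n_def)
    then have c: "of_real (n 2) * Q 3 b - of_real (n 3) * Q 2 b = (\<i> * of_real r) * Q 1 b"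
      "of_real (n 3) * Q 1 b - of_real (n 1) * Q 3 b = (\<i> * of_real r) * Q 2 b"
      "of_real (n 1) * Q 2 b - of_real (n 2) * Q 1 b = (\<i> * of_real r) * Q 3 b"
      using null(3-5)[OF that(2)] t by (simp_all flip: diff_divide_distrib)
    have ir: "(\<i> * complex_of_real r) * (\<i> * of_real r) = -1"
      using r by auto
    have cPP: "complex_of_real (P 1) * of_real (P 1) + of_real (P 2) * of_real (P 2) + of_real (P 3) * of_real (P 3) = 1"
      using arg_cong[OF PP, of complex_of_real] by (simp add: power2_eq_square)
    have cnP: "complex_of_real (n 1) * of_real (P 1) + of_real (n 2) * of_real (P 2) + of_real (n 3) * of_real (P 3) = 0"
      using arg_cong[OF nP, of complex_of_real] by simp
    show ?thesis
      using cross_eigenvector_expand[OF c ir cPP cnP] that(1) by (auto simp: m_def d_def N_def)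
  qed
  \<comment> \<open>Every column is a multiple \<open>d b\<close> of \<open>m\<close>. Because
    \<open>Q\<close> is symmetric, \<open>d\<close> is itself proportional to \<open>m\<close>, with
    this factor.\<close>
  define c where "c = P 1 * d 1 + P 2 * d 2 + P 3 * d 3"
  have Qc: "Q a b = c * (m a * m b)" if "a \<in> {1, 2, 3}" "b \<in> {1, 2, 3}" for a b
  proof -
    have "Q i b = d i * m b" if "i \<in> {1, 2, 3}" for i
    proof -
      have "Q i b = Q b i" using that \<open>b \<in> {1, 2, 3}\<close> by (auto simp: sym)
      then show ?thesis using col[of b i] that \<open>b \<in> {1, 2, 3}\<close> by simp
    qed
    then have "d b = c * m b"
      by (simp add: d_def[of b] c_def algebra_simps)
    then show ?thesis using col[OF that] by simp
  qed
  \<comment> \<open>Squared Frobenius norms in \<open>Q = c m m^T\<close>: since \<open>m\<close>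
    has squared norm 2, \<open>t\<close> is four times the squared modulus of
    \<open>c\<close>.\<close>
  have "t = (cmod c)\<^sup>2 * ((cmod (m 1))\<^sup>2 + (cmod (m 2))\<^sup>2 + (cmod (m 3))\<^sup>2) * ((cmod (m 1))\<^sup>2 + (cmod (m 2))\<^sup>2 + (cmod (m 3))\<^sup>2)"
    unfolding t_def by (simp add: Qc norm_mult power_mult_distrib algebra_simps)
  then have "(cmod c)\<^sup>2 = (k * k / 2)\<^sup>2"
    unfolding mm using k(2) by (simp add: power2_eq_square)
  then have cc: "cmod c = k * k / 2"
    using k(1) by (simp add: power2_eq_iff_nonneg)
  \<comment> \<open>The modulus of \<open>c\<close> is prescribed by \<open>t\<close>, so its
    argument is the only freedom left: the duality rotation.\<close>
  define \<theta> where "\<theta> = Arg2pi c"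
  have c\<theta>: "c = of_real (k * k / 2) * exp (\<i> * of_real \<theta>)"
    using Arg2pi_eq[of c] unfolding cc \<theta>_def .
  define F where "F = frame_comp2 e L"
  define G where "G = frame_comp2 e L0"
  have F: "F i j = gprod g (e i) l * P j - P i * gprod g (e j) l" for i j
    unfolding F_def L_def frame_comp2_wedge2 P_def ..
  have F_flip: "F j i = - F i j" for i j
    by (simp add: F)
  have G: "G i j = (1 / of_real (sqrt 2)) * (of_real (F i j) - \<i> * of_real (frame_dual r F i j))" for i j
  proof -
    have "G i j = frame_comp2 e (\<lambda>\<alpha> \<beta>. (1 / of_real (sqrt 2)) * (of_real (L \<alpha> \<beta>) - \<i> * of_real (hodge2 g \<eta> L \<alpha> \<beta>))) i j"
      unfolding G_def L0_def by simp
    also have "\<dots> = (1 / of_real (sqrt 2)) * (of_real (F i j) - \<i> * of_real (frame_comp2 e (hodge2 g \<eta> L) i j))"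
      by (simp only: F_def frame_comp2_def frame_comp_linear)
    finally show ?thesis
      by (simp only: frame_comp2_hodge2_eq F_def)
  qed
  have G_sd: "self_dual_form r G"
    using self_dual_form_self_dual_part[of F r "1 / of_real (sqrt 2)", OF F_flip r] by (simp only: G[abs_def, symmetric])
  \<comment> \<open>The product of two such factors is \<open>k * k / 2\<close>, exactly the modulus
    of \<open>c\<close>; this is the role of the normalisation by \<open>sqrt 2\<close> in
    \<open>L0\<close>.\<close>
  have G_time: "G 0 a = - of_real (k / sqrt 2) * m a" if "a \<in> {1, 2, 3}" for a
  proof -
    have "P 0 = 0" "n 0 = 1"
      using p(1) t by (simp_all add: P_def n_def br_time)
    then have "F 0 a = - (k * P a)"
      by (simp add: F l')
    moreover have "frame_dual r F 0 a = - (r * (k * N a))"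
      using that by (auto simp: frame_dual_values(2-4)[of F, OF F_flip] F l' N_def algebra_simps)
    ultimately show ?thesis
      by (simp add: G m_def field_simps)
  qed
  have "sd i j i' j' = exp (\<i> * of_real \<theta>) * (G i j * G i' j')" for i j i' j'
  proof (rule sd_ext)
    show "self_dual_form r (\<lambda>i' j'. exp (\<i> * of_real \<theta>) * (G i j * G i' j'))" for i j
      unfolding mult.assoc[symmetric] by (rule self_dual_form_scale[OF G_sd])
    show "self_dual_form r (\<lambda>i j. exp (\<i> * of_real \<theta>) * (G i j * G i' j'))" for i' j'
      unfolding mult.commute[of _ "G i' j'"] mult.assoc[symmetric] by (rule self_dual_form_scale[OF G_sd])
    show "Q a b = exp (\<i> * of_real \<theta>) * (G 0 a * G 0 b)" if "a \<in> {1, 2, 3}" "b \<in> {1, 2, 3}" for a b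
    proof -
      have "complex_of_real (k * k / 2) = of_real (k / sqrt 2) * of_real (k / sqrt 2)"
        by (simp flip: of_real_mult)
      then show ?thesis
        by (simp only: Qc[OF that] G_time[OF that(1)] G_time[OF that(2)] c\<theta>
            mult_minus_left mult_minus_right minus_minus mult_ac)
    qed
  qed
  then have "self_dual_weyl g \<eta> W = (\<lambda>\<alpha> \<beta> \<mu> \<nu>. exp (\<i> * of_real \<theta>) * (L0 \<alpha> \<beta> * L0 \<mu> \<nu>))"
    by (intro frame_comp4_ext)
      (simp only: sd_def[symmetric] G_def frame_comp4_def frame_comp2_def frame_comp_linear)
  then show ?thesis by blast
qed

end

section \<open>From the given vectors to the adapted frame\<close>

theorem theorem2:
  fixes g :: "real^4^4" and \<eta> W T :: "real tensor4"
    and u l w x p :: "real^4" and X \<Lambda> L :: "real tensor2"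
    and L0 :: "complex tensor2" and W0 :: "complex tensor4"
  assumes "lorentzian g" and "volume_element g \<eta>"
    and "weyl_tensor g W"
    and "T = bel_robinson g \<eta> W"
    and "T \<noteq> (\<lambda>_ _ _ _. 0)"
    and "tensor4_square g T = (\<lambda>_ _ _ _. 0)"
    and "time_like g u"
    and "X = (\<lambda>\<alpha> \<beta>. u $ \<alpha> * u $ \<beta>)"
    and "\<Lambda> = (\<lambda>\<alpha> \<beta>. tensor4_apply T X \<alpha> \<beta> / sqrt (tensor4_quad T X))"
    and "l = - (tensor2_apply g \<Lambda> u /\<^sub>R sqrt (tensor2_quad \<Lambda> u))"
    and "x = hodge3 g \<eta> (wedge3 g l u w)"
    and "x \<noteq> 0"
    and "p = x /\<^sub>R sqrt (gprod g x x)"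
    and "L = wedge2 g l p"
    and "L0 = (\<lambda>\<alpha> \<beta>. (of_real (L \<alpha> \<beta>) - \<i> * of_real (hodge2 g \<eta> L \<alpha> \<beta>)) / of_real (sqrt 2))"
    and "W0 = (\<lambda>\<alpha> \<beta> \<mu> \<nu>. L0 \<alpha> \<beta> * L0 \<mu> \<nu>)"
  shows "\<exists>\<theta>::real. self_dual_weyl g \<eta> W =
           (\<lambda>\<alpha> \<beta> \<mu> \<nu>. exp (\<i> * of_real \<theta>) * W0 \<alpha> \<beta> \<mu> \<nu>)"
proof -
  obtain e c where frame: "orthonormal_frame g e" and c: "c > 0" and u: "u = c *\<^sub>R e 0"
    using adapted_frame[OF assms(1,7)] .
  interpret orthonormal_frame g e by (rule frame)
  obtain r where r: "r = 1 \<or> r = -1" and vol: "\<And>i j k l. frame_comp4 e \<eta> i j k l = r * levi_civita i j k l"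
    using frame_comp4_volume_element[OF assms(2)] by blast
  interpret weyl_frame g e \<eta> W r
    by unfold_locales (use assms(3) r vol in auto)
  have "bel_robinson g \<eta> W \<noteq> (\<lambda>_ _ _ _. 0)" "tensor4_square g (bel_robinson g \<eta> W) = (\<lambda>_ _ _ _. 0)"
    using assms(4-6) by simp_all
  note null = this
  have t: "t > 0" by (rule null_structure(1)[OF null])
  have br: "br i 0 0 0 = frame_comp4 e T i 0 0 0" for i
    unfolding br_def assms(4) ..
  \<comment> \<open>Three slots are filled with \<open>u = c e 0\<close>, each contributing a factor
    \<open>c\<close>.\<close>
  have TX: "(\<Sum>\<alpha>\<in>UNIV. e i $ \<alpha> * (\<Sum>\<beta>\<in>UNIV. tensor4_apply T X \<alpha> \<beta> * u $ \<beta>)) = c ^ 3 * br i 0 0 0" for i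
    unfolding br
    by (simp add: tensor4_apply_def assms(8) u frame_comp4_def frame_comp2_def frame_comp_def
        sum_distrib_left sum_distrib_right power3_eq_cube mult_ac)
  have quad: "tensor4_quad T X = c ^ 4 * t"
  proof -
    have "tensor4_quad T X = c * (\<Sum>\<alpha>\<in>UNIV. e 0 $ \<alpha> * (\<Sum>\<beta>\<in>UNIV. tensor4_apply T X \<alpha> \<beta> * u $ \<beta>))"
      by (simp add: tensor4_quad_def tensor4_apply_def assms(8) u sum_distrib_left sum_distrib_right mult_ac)
    also have "\<dots> = c ^ 4 * t"
      unfolding TX br_time by (simp add: power4_eq_xxxx power3_eq_cube)
    finally show ?thesis .
  qed
  define k where "k = sqrt (sqrt t)"
  have k: "k > 0" "t = (k * k) * (k * k)"
    using t by (simp_all add: k_def)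
  have sqrt_quad: "sqrt (tensor4_quad T X) = c * c * (k * k)"
    unfolding quad by (rule real_sqrt_unique) (use c k in \<open>simp_all add: power2_eq_square power4_eq_xxxx mult_ac\<close>)
  have quad2: "tensor2_quad \<Lambda> u = c * c * (k * k)"
  proof -
    have "tensor2_quad \<Lambda> u = tensor4_quad T X / sqrt (tensor4_quad T X)"
      by (simp add: tensor2_quad_def tensor4_quad_def tensor4_apply_def assms(8,9) sum_divide_distrib
          sum_distrib_left sum_distrib_right mult_ac)
    also have "\<dots> = sqrt (tensor4_quad T X)"
      by (rule real_div_sqrt) (use quad c t in simp)
    finally show ?thesis
      unfolding sqrt_quad .
  qed
  have sqrt_quad2: "sqrt (tensor2_quad \<Lambda> u) = c * k"
    unfolding quad2 by (rule real_sqrt_unique) (use c k in \<open>simp_all add: power2_eq_square mult_ac\<close>)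
  have l: "gprod g (e i) l = - (sqrt (sqrt t) * (br i 0 0 0 / t))" for i
  proof -
    have "gprod g (e i) (tensor2_apply g \<Lambda> u) =
        (\<Sum>\<alpha>\<in>UNIV. e i $ \<alpha> * (\<Sum>\<beta>\<in>UNIV. tensor4_apply T X \<alpha> \<beta> * u $ \<beta>)) / sqrt (tensor4_quad T X)"
      by (simp add: tensor2_apply_def gprod_raise1 assms(9) flip: sum_divide_distrib)
    \<comment> \<open>The powers of \<open>c\<close> cancel, so \<open>l\<close> does not depend on
      the length of \<open>u\<close>; the remaining factor is \<open>1 / k^3 = k / t\<close>, since
      \<open>t = k^4\<close>.\<close>
    then have "gprod g (e i) l = - (c ^ 3 * br i 0 0 0 / (c * c * (k * k)) / (c * k))"
      unfolding assms(10) TX sqrt_quad sqrt_quad2 by (simp add: gprod_linear divide_inverse mult_ac)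
    also have "\<dots> = - (k * (br i 0 0 0 / t))"
      using c k(1) by (simp add: k(2) power3_eq_cube field_simps)
    finally show ?thesis unfolding k_def .
  qed
  have lx: "gprod g l x = 0" and ux: "gprod g u x = 0"
    unfolding assms(11) by (rule hodge3_orthogonal[OF assms(2)])+
  have x0: "gprod g (e 0) x = 0"
    using ux c by (simp add: u gprod_linear)
  have xx: "gprod g x x = (gprod g (e 1) x)\<^sup>2 + ((gprod g (e 2) x)\<^sup>2 + (gprod g (e 3) x)\<^sup>2)"
    unfolding gprod_frame[of x x] by (simp add: sum_index4 x0 power2_eq_square)
  \<comment> \<open>Being orthogonal to the time axis, \<open>x\<close> is purely spatial, where the
    metric is positive definite. This makes the normalisation of \<open>p\<close>
    legitimate.\<close>
  have "gprod g x x > 0"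
  proof (rule ccontr)
    assume "\<not> gprod g x x > 0"
    then have "gprod g (e 1) x = 0" "gprod g (e 2) x = 0" "gprod g (e 3) x = 0"
      unfolding xx by (smt (verit) zero_le_power2 zero_eq_power2)+
    then have "gprod g (e i) x = 0" for i
      using index4_cases[of i] x0 by auto
    then show False
      using eq_zero_of_frame assms(12) by blast
  qed
  then have p: "gprod g (e 0) p = 0" "gprod g p p = 1" "gprod g l p = 0"
    by (simp_all add: assms(13) gprod_linear x0 lx flip: power2_eq_square) (simp add: field_simps)
  show ?thesis
    using self_dual_weyl_null[OF null l p] unfolding assms(14-16) .
qed

end
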